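(* Let $n\geq 3$ be an odd integer with $3\nmid n$, and let $q$ be an odd prime. Then for all but finitely many odd primes $p\neq q$ (with $q^2<p^n$), the class number of $K_{p,q}=\mathbb{Q}(\sqrt{q^2-p^n})$ is divisible by $n$. Furthermore, as $p$ ranges over such odd primes, the fields $K_{p,q}$ include infinitely many pairwise distinct fields.
   Context: For positive integers $t,x$ with $x^2<t^n$, $K_{t,x}$ denotes the imaginary quadratic field $\mathbb{Q}(\sqrt{x^2-t^n})$. *)

theory Defs
  imports Complex_Main "HOL-Computational_Algebra.Polynomial"
begin

definition quad_field :: "int \<Rightarrow> complex set" where
  "quad_field d = {of_real a + of_real b * csqrt (of_int d) | a b. a \<in> \<rat> \<and> b \<in> \<rat>}"

definition ring_of_integers :: "complex set \<Rightarrow> complex set" where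
  "ring_of_integers K = {z \<in> K. algebraic_int z}"

definition nonzero_ideals :: "complex set \<Rightarrow> complex set set" where
  "nonzero_ideals R = {I. I \<subseteq> R \<and> 0 \<in> I \<and> I \<noteq> {0} \<and>
      (\<forall>x\<in>I. \<forall>y\<in>I. x + y \<in> I) \<and> (\<forall>x\<in>I. - x \<in> I) \<and>
      (\<forall>r\<in>R. \<forall>x\<in>I. r * x \<in> I)}"

definition ideal_class_rel :: "complex set \<Rightarrow> (complex set \<times> complex set) set" where
  "ideal_class_rel R = {(I, J). I \<in> nonzero_ideals R \<and> J \<in> nonzero_ideals R \<and>
      (\<exists>\<alpha>\<in>R - {0}. \<exists>\<beta>\<in>R - {0}. (\<lambda>x. \<alpha> * x) ` I = (\<lambda>x. \<beta> * x) ` J)}"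

definition class_number :: "complex set \<Rightarrow> nat" where
  "class_number K = card (nonzero_ideals (ring_of_integers K) // ideal_class_rel (ring_of_integers K))"

definition K_field :: "nat \<Rightarrow> nat \<Rightarrow> nat \<Rightarrow> complex set" where
  "K_field n t x = quad_field (int x ^ 2 - int t ^ n)"

end

theory Submission
  imports Defs "HOL-Number_Theory.Residues"
begin

text \<open>
  Let \<open>\<alpha> = q + \<surd>(q\<^sup>2 - p\<^sup>n)\<close>, an element of norm \<open>p\<^sup>n\<close> and trace \<open>2q\<close>. Multiplication by the ideal
  \<open>\<aa> = (p, \<alpha>)\<close> acts on the ideal classes, and \<open>\<aa>\<^sup>n = (\<alpha>)\<close>, so \<open>n\<close> divides the class number as soon as all
  orbits have exactly \<open>n\<close> elements. Otherwise \<open>\<aa>\<^sup>e I = c I\<close> for some ideal \<open>I\<close> and some proper divisor \<open>e\<close>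
  of \<open>n = e k\<close>; then \<open>c\<^sup>k = u \<alpha>\<close> with a unit \<open>u\<close>. Since \<open>u\<^sup>1\<^sup>2 = 1\<close> and \<open>k\<^sup>2 \<equiv> 1\<close> modulo 12, the unit can be
  absorbed and \<open>\<alpha> = z\<^sup>k\<close> for an integer \<open>z\<close> of norm \<open>p\<^sup>e\<close> and trace \<open>t\<close>. The power sum \<open>z\<^sup>k + cnj z\<^sup>k = 2q\<close>
  is a multiple of \<open>t\<close>, which leaves finitely many \<open>t\<close>, and for fixed \<open>t\<close> it is a polynomial of degree
  \<open>(k - 1) / 2 > 0\<close> in \<open>p\<^sup>e\<close>, which leaves finitely many \<open>p\<close>.

  For the infinitude of fields, suppose that the finitely many fields \<open>\<rat>(\<surd>-D)\<close>, \<open>D \<in> S\<close>, exhaust the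
  family. There is a large prime \<open>p \<equiv> 3\<close> modulo 4 modulo which every \<open>D \<in> S\<close> is a square. All \<open>-D\<close> are then
  nonresidues modulo \<open>p\<close>, although \<open>p\<^sup>n - q\<^sup>2 = D r\<^sup>2\<close> with \<open>r\<close> rational makes one of them a residue.
\<close>

subsection \<open>Integers of imaginary quadratic fields\<close>

text \<open>For \<open>r = a / b\<close> in lowest terms every power of \<open>b\<close> must divide
  \<open>C\<close>; if \<open>b \<ge> 2\<close>, the exponent \<open>\<bar>C\<bar>\<close> is
  already too large.\<close>

lemma rat_bounded_denominator_imp_Ints:
  fixes r :: "'a :: field_char_0"
  assumes "r \<in> \<rat>" "C \<noteq> 0" and int: "\<And>k. of_int C * r ^ k \<in> \<int>"
  shows "r \<in> \<int>"
proof -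
  obtain a b where ab: "b > 0" "coprime a b" "r = of_int a / of_int b"
    using assms(1) by (auto elim: Rats_cases')
  have pow: "b ^ k dvd C" for k
  proof -
    obtain m where m: "of_int C * r ^ k = of_int m"
      using int[of k] by (auto elim: Ints_cases)
    have "of_int (C * a ^ k) = (of_int (m * b ^ k) :: 'a)"
      using m ab by (simp add: field_simps power_divide)
    hence "b ^ k dvd C * a ^ k"
      by (simp only: of_int_eq_iff) simp
    moreover have "coprime (b ^ k) (a ^ k)"
      using ab by (simp add: coprime_commute)
    ultimately show ?thesis
      by (simp add: coprime_dvd_mult_left_iff)
  qed
  have "b = 1"
  proof (rule ccontr)
    assume "b \<noteq> 1"
    hence "b \<ge> 2" using ab by simp
    define k where "k = nat \<bar>C\<bar>"
    have "int k < 2 ^ k" by (metis of_nat_less_two_power)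
    also have "(2::int) ^ k \<le> b ^ k" using \<open>b \<ge> 2\<close> by (intro power_mono) auto
    also have "\<dots> \<le> \<bar>C\<bar>" using pow[of k] \<open>C \<noteq> 0\<close> by (simp add: dvd_imp_le_int zdvd_imp_le ab)
    finally show False by (simp add: k_def)
  qed
  thus ?thesis using ab by simp
qed

text \<open>The order Z[sqrt d]. It can be smaller than the ring of integers, since \<open>d\<close>
  may have square factors or be congruent to 1 modulo 4.\<close>

definition quad_order :: "int \<Rightarrow> complex set" where
  "quad_order d = {of_int u + of_int v * csqrt (of_int d) | u v. True}"

text \<open>Working with almost integral elements (all powers have a common denominator) instead of
  roots of monic polynomials makes closure under products and the integrality of trace and norm immediate.\<close>

definition almost_integral :: "int \<Rightarrow> complex \<Rightarrow> bool" where
  "almost_integral d z \<longleftrightarrow> (\<exists>D. D \<noteq> 0 \<and> (\<forall>k. of_int D * z ^ k \<in> quad_order d))"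

lemma quad_order_of_int [simp]: "of_int u \<in> quad_order d"
  unfolding quad_order_def by (rule CollectI, rule exI[of _ u], rule exI[of _ 0]) simp

lemma quad_order_add: "x \<in> quad_order d \<Longrightarrow> y \<in> quad_order d \<Longrightarrow> x + y \<in> quad_order d"
proof -
  assume "x \<in> quad_order d" "y \<in> quad_order d"
  then obtain u v u' v' where "x = of_int u + of_int v * csqrt (of_int d)" "y = of_int u' + of_int v' * csqrt (of_int d)"
    unfolding quad_order_def by blast
  hence "x + y = of_int (u + u') + of_int (v + v') * csqrt (of_int d)"
    by (simp add: algebra_simps)
  thus ?thesis unfolding quad_order_def by blast
qed

lemma csqrt_mult_self: "csqrt z * csqrt z = z"
  using power2_csqrt[of z] by (simp add: power2_eq_square)

lemma quad_order_mult: "x \<in> quad_order d \<Longrightarrow> y \<in> quad_order d \<Longrightarrow> x * y \<in> quad_order d"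
proof -
  assume "x \<in> quad_order d" "y \<in> quad_order d"
  then obtain u v u' v' where *: "x = of_int u + of_int v * csqrt (of_int d)" "y = of_int u' + of_int v' * csqrt (of_int d)"
    unfolding quad_order_def by blast
  have "x * y = of_int u * of_int u' + of_int v * of_int v' * (csqrt (of_int d) * csqrt (of_int d))
      + (of_int u * of_int v' + of_int u' * of_int v) * csqrt (of_int d)"
    unfolding * by (simp add: algebra_simps)
  also have "\<dots> = of_int (u * u' + v * v' * d) + of_int (u * v' + u' * v) * csqrt (of_int d)"
    unfolding csqrt_mult_self by simp
  finally show ?thesis unfolding quad_order_def by blast
qed

lemma quad_order_sum: "(\<And>i. i \<in> S \<Longrightarrow> f i \<in> quad_order d) \<Longrightarrow> sum f S \<in> quad_order d"
  by (induction S rule: infinite_finite_induct)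
     (use quad_order_of_int[of 0 d] in \<open>auto intro: quad_order_add\<close>)

lemma almost_integral_mult:
  assumes "almost_integral d x" "almost_integral d y"
  shows "almost_integral d (x * y)"
proof -
  obtain D E where D: "D \<noteq> 0" "\<And>k. of_int D * x ^ k \<in> quad_order d"
    and E: "E \<noteq> 0" "\<And>k. of_int E * y ^ k \<in> quad_order d"
    using assms unfolding almost_integral_def by blast
  have "of_int (D * E) * (x * y) ^ k = (of_int D * x ^ k) * (of_int E * y ^ k)" for k
    by (simp add: power_mult_distrib)
  hence "of_int (D * E) * (x * y) ^ k \<in> quad_order d" for k
    by (metis D(2) E(2) quad_order_mult)
  thus ?thesis using D E unfolding almost_integral_def by (intro exI[of _ "D * E"]) auto
qed

text \<open>Every binomial term contains one power of \<open>x\<close> and one of \<open>y\<close>,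
  so \<open>D * E\<close> clears denominators uniformly in \<open>k\<close>.\<close>

lemma add_power_in_quad_order:
  assumes D: "\<And>k. of_int D * x ^ k \<in> quad_order d" and E: "\<And>k. of_int E * y ^ k \<in> quad_order d"
  shows "of_int (D * E) * (x + y) ^ k \<in> quad_order d"
proof -
  have "of_int (D * E) * (x + y) ^ k =
      (\<Sum>i\<le>k. of_int (int (k choose i)) * ((of_int D * x ^ i) * (of_int E * y ^ (k - i))))"
    unfolding binomial_ring sum_distrib_left by (intro sum.cong refl) simp
  also have "\<dots> \<in> quad_order d"
    by (intro quad_order_sum quad_order_mult D E quad_order_of_int)
  finally show ?thesis .
qed

lemma quad_order_imp_almost_integral:
  assumes "z \<in> quad_order d" shows "almost_integral d z"
proof -
  have "z ^ k \<in> quad_order d" for k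
    using assms quad_order_of_int[of 1 d] by (induction k) (auto intro: quad_order_mult)
  thus ?thesis unfolding almost_integral_def by (intro exI[of _ 1]) auto
qed

lemma quad_field_denominator:
  assumes "z \<in> quad_field d"
  obtains D where "D \<noteq> 0" "of_int D * z \<in> quad_order d"
proof -
  obtain a b where ab: "z = of_real a + of_real b * csqrt (of_int d)" "a \<in> \<rat>" "b \<in> \<rat>"
    using assms unfolding quad_field_def by blast
  obtain u v where u: "v > 0" "a = of_int u / of_int v"
    using ab(2) by (auto elim: Rats_cases')
  obtain u' v' where u': "v' > 0" "b = of_int u' / of_int v'"
    using ab(3) by (auto elim: Rats_cases')
  have "of_int (v * v') * z = of_int (u * v') + of_int (u' * v) * csqrt (of_int d)"
    unfolding ab(1) u(2) u'(2) using u(1) u'(1) by (simp add: field_simps)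
  hence "of_int (v * v') * z \<in> quad_order d" unfolding quad_order_def by blast
  thus ?thesis using that[of "v * v'"] u(1) u'(1) by auto
qed

lemma quad_field_denominator_iff:
  "z \<in> quad_field d \<longleftrightarrow> (\<exists>D. D \<noteq> 0 \<and> of_int D * z \<in> quad_order d)"
proof
  assume "\<exists>D. D \<noteq> 0 \<and> of_int D * z \<in> quad_order d"
  then obtain D u v where D: "D \<noteq> 0" "of_int D * z = of_int u + of_int v * csqrt (of_int d)"
    unfolding quad_order_def by blast
  hence "z = (of_int u + of_int v * csqrt (of_int d)) / of_int D"
    by (simp add: field_simps)
  also have "\<dots> = of_real (of_int u / of_int D) + of_real (of_int v / of_int D) * csqrt (of_int d)"
    by (simp add: field_simps add_divide_distrib)
  finally show "z \<in> quad_field d" unfolding quad_field_def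
    by (intro CollectI exI[of _ "of_int u / of_int D"] exI[of _ "of_int v / of_int D"] conjI) auto
qed (blast elim: quad_field_denominator)

text \<open>If \<open>D\<close> clears the denominator of \<open>z\<close> and \<open>m\<close> is
  the degree of a monic equation, then \<open>D ^ m\<close> clears the powers up to
  \<open>z ^ m\<close>. The equation writes all higher powers as integer combinations of lower ones,
  so \<open>D ^ m\<close> clears them as well.\<close>

lemma algebraic_int_imp_almost_integral:
  assumes "z \<in> quad_field d" "algebraic_int z"
  shows "almost_integral d z"
proof -
  obtain D where D: "D \<noteq> 0" "of_int D * z \<in> quad_order d"
    using assms(1) by (rule quad_field_denominator)
  obtain p where p: "poly (map_poly of_int p) z = 0" "lead_coeff p = (1::int)"
    using assms(2) unfolding algebraic_int_altdef_ipoly by blast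
  define m where "m = degree p"
  have Dz: "of_int D ^ i * z ^ i \<in> quad_order d" for i
  proof (induction i)
    case (Suc i)
    have "of_int D ^ Suc i * z ^ Suc i = (of_int D * z) * (of_int D ^ i * z ^ i)" by simp
    thus ?case using quad_order_mult[OF D(2) Suc] by metis
  qed (use quad_order_of_int[of 1 d] in simp)
  have small: "of_int (D ^ m) * z ^ i \<in> quad_order d" if "i \<le> m" for i
  proof -
    have "of_int (D ^ m) * z ^ i = of_int (D ^ (m - i)) * (of_int D ^ i * z ^ i)"
      using that by (simp flip: power_add mult.assoc)
    thus ?thesis using Dz quad_order_mult quad_order_of_int by metis
  qed
  have "(\<Sum>i\<le>m. of_int (Polynomial.coeff p i) * z ^ i) = 0"
    using p(1) by (simp add: poly_altdef m_def degree_map_poly coeff_map_poly)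
  hence zm: "z ^ m = (\<Sum>i<m. of_int (- Polynomial.coeff p i) * z ^ i)"
    using p(2) by (simp add: m_def lessThan_Suc_atMost[symmetric] sum_negf eq_neg_iff_add_eq_0 add.commute)
  have "of_int (D ^ m) * z ^ k \<in> quad_order d" for k
  proof (induction k rule: less_induct)
    case (less k)
    show ?case
    proof (cases "k \<le> m")
      case False
      have "z ^ k = z ^ (k - m) * z ^ m" using False by (simp flip: power_add)
      also have "\<dots> = (\<Sum>i<m. of_int (- Polynomial.coeff p i) * z ^ (i + (k - m)))"
        unfolding zm sum_distrib_left by (simp add: power_add mult_ac)
      finally have "of_int (D ^ m) * z ^ k =
          (\<Sum>i<m. of_int (- Polynomial.coeff p i) * (of_int (D ^ m) * z ^ (i + (k - m))))"
        by (simp add: sum_distrib_left mult_ac)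
      also have "\<dots> \<in> quad_order d"
        using False by (intro quad_order_sum quad_order_mult quad_order_of_int less) auto
      finally show ?thesis .
    qed (use small in auto)
  qed
  thus ?thesis unfolding almost_integral_def using D by (intro exI[of _ "D ^ m"]) auto
qed

abbreviation quad_ints :: "int \<Rightarrow> complex set" where
  "quad_ints d \<equiv> ring_of_integers (quad_field d)"

text \<open>Every complex \<open>z\<close> is a root of the monic quadratic with coefficients given
  by \<open>z + cnj z\<close> and \<open>z * cnj z\<close>.\<close>

lemma algebraic_int_of_trace_norm:
  assumes "2 * Re z \<in> \<int>" "(cmod z)\<^sup>2 \<in> \<int>"
  shows "algebraic_int z"
proof -
  obtain t m where tm: "2 * Re z = of_int t" "(cmod z)\<^sup>2 = of_int m"
    using assms by (auto elim!: Ints_cases)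
  show ?thesis
  proof (rule algebraic_int.intros)
    have "of_int t = z + cnj z" "of_int m = z * cnj z"
      using tm by (metis complex_add_cnj of_real_of_int_eq, metis complex_norm_square of_real_of_int_eq)
    thus "poly [:of_int m, - of_int t, 1:] z = 0"
      by (simp add: algebra_simps)
  qed (auto simp: coeff_pCons split: nat.splits)
qed

section \<open>Conjugation, trace and norm for negative \<open>d\<close>\<close>

context
  fixes d :: int
  assumes neg: "d < 0"
begin

lemma cnj_csqrt_neg: "cnj (csqrt (of_int d)) = - csqrt (of_int d)"
  using neg by (simp add: complex_eq_iff)

lemma cnj_quad_order: "z \<in> quad_order d \<Longrightarrow> cnj z \<in> quad_order d"
proof -
  assume "z \<in> quad_order d"
  then obtain u v where "z = of_int u + of_int v * csqrt (of_int d)"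
    unfolding quad_order_def by blast
  hence "cnj z = of_int u + of_int (- v) * csqrt (of_int d)"
    by (simp add: cnj_csqrt_neg)
  thus ?thesis unfolding quad_order_def by blast
qed

lemma quad_order_real_imp_Ints:
  assumes "of_real x \<in> quad_order d" shows "x \<in> \<int>"
proof -
  obtain u v where uv: "of_real x = of_int u + of_int v * csqrt (of_int d)"
    using assms unfolding quad_order_def by blast
  show ?thesis using arg_cong[OF uv, of Re] neg by simp
qed

lemma quad_field_trace_norm_Rats:
  assumes "z \<in> quad_field d"
  shows "2 * Re z \<in> \<rat>" "(cmod z)\<^sup>2 \<in> \<rat>"
proof -
  obtain a b where ab: "z = of_real a + of_real b * csqrt (of_int d)" "a \<in> \<rat>" "b \<in> \<rat>"
    using assms unfolding quad_field_def by blast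
  show "2 * Re z \<in> \<rat>" using ab neg by simp
  have "(cmod z)\<^sup>2 = a\<^sup>2 - b\<^sup>2 * of_int d"
    using neg by (simp add: ab(1) cmod_power2 power_mult_distrib)
  thus "(cmod z)\<^sup>2 \<in> \<rat>" using ab by simp
qed

text \<open>If \<open>D\<close> clears all powers of \<open>z\<close>, it clears those of
  \<open>cnj z\<close> too, so \<open>D * D\<close> clears all powers of the sum and of the product.
  Both are rational, and real elements of the order are integers.\<close>

lemma almost_integral_trace_norm:
  assumes "almost_integral d z"
  shows "2 * Re z \<in> \<int>" "(cmod z)\<^sup>2 \<in> \<int>"
proof -
  obtain D where D: "D \<noteq> 0" "\<And>k. of_int D * z ^ k \<in> quad_order d"
    using assms unfolding almost_integral_def by blast
  have K: "z \<in> quad_field d"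
    using D(1) D(2)[of 1] unfolding quad_field_denominator_iff by auto
  have D': "of_int D * cnj z ^ k \<in> quad_order d" for k
    using cnj_quad_order[OF D(2)[of k]] by simp
  show "2 * Re z \<in> \<int>"
  proof (rule rat_bounded_denominator_imp_Ints)
    show "real_of_int (D * D) * (2 * Re z) ^ k \<in> \<int>" for k
    proof (rule quad_order_real_imp_Ints)
      have "of_real (real_of_int (D * D) * (2 * Re z) ^ k) = of_int (D * D) * (z + cnj z) ^ k"
        by (simp add: complex_add_cnj)
      thus "complex_of_real (real_of_int (D * D) * (2 * Re z) ^ k) \<in> quad_order d"
        using add_power_in_quad_order[OF D(2) D'] by metis
    qed
  qed (use D quad_field_trace_norm_Rats[OF K] in auto)
  show "(cmod z)\<^sup>2 \<in> \<int>"
  proof (rule rat_bounded_denominator_imp_Ints)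
    show "real_of_int (D * D) * ((cmod z)\<^sup>2) ^ k \<in> \<int>" for k
    proof (rule quad_order_real_imp_Ints)
      have "complex_of_real ((cmod z)\<^sup>2) = z * cnj z"
        by (simp only: complex_norm_square)
      hence "complex_of_real (real_of_int (D * D) * ((cmod z)\<^sup>2) ^ k) = of_int (D * D) * (z * cnj z) ^ k"
        by simp
      also have "\<dots> = (of_int D * z ^ k) * (of_int D * cnj z ^ k)"
        by (simp add: power_mult_distrib)
      finally show "complex_of_real (real_of_int (D * D) * ((cmod z)\<^sup>2) ^ k) \<in> quad_order d"
        using quad_order_mult[OF D(2) D'] by metis
    qed
  qed (use D quad_field_trace_norm_Rats[OF K] in auto)
qed

text \<open>This closes the circle: algebraic integers are almost integral, these have integral
  trace and norm, and such numbers solve a monic quadratic.\<close>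

lemma ring_of_integers_iff: "z \<in> ring_of_integers (quad_field d) \<longleftrightarrow> almost_integral d z"
proof
  assume a: "almost_integral d z"
  then obtain D where D: "D \<noteq> 0" "of_int D * z ^ 1 \<in> quad_order d"
    unfolding almost_integral_def by blast
  hence "z \<in> quad_field d"
    unfolding quad_field_denominator_iff by auto
  thus "z \<in> ring_of_integers (quad_field d)"
    using algebraic_int_of_trace_norm almost_integral_trace_norm[OF a]
    by (simp add: ring_of_integers_def)
qed (simp add: ring_of_integers_def algebraic_int_imp_almost_integral)

lemma quad_ints_mult: "x \<in> quad_ints d \<Longrightarrow> y \<in> quad_ints d \<Longrightarrow> x * y \<in> quad_ints d"
  by (simp add: ring_of_integers_iff almost_integral_mult)

lemma quad_ints_of_int [simp]: "of_int m \<in> quad_ints d"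
  by (simp add: ring_of_integers_iff quad_order_imp_almost_integral)

lemma quad_ints_1 [simp]: "1 \<in> quad_ints d"
  using quad_ints_of_int[of 1] by (simp del: quad_ints_of_int)

lemma quad_ints_power: "x \<in> quad_ints d \<Longrightarrow> x ^ k \<in> quad_ints d"
  by (induction k) (auto intro: quad_ints_mult)

lemma quad_ints_cnj: "x \<in> quad_ints d \<Longrightarrow> cnj x \<in> quad_ints d"
proof -
  assume "x \<in> quad_ints d"
  then obtain D where D: "D \<noteq> 0" "\<And>k. of_int D * x ^ k \<in> quad_order d"
    by (auto simp: ring_of_integers_iff almost_integral_def)
  have "of_int D * cnj x ^ k \<in> quad_order d" for k
    using cnj_quad_order[OF D(2)[of k]] by simp
  thus ?thesis using D(1) by (auto simp: ring_of_integers_iff almost_integral_def)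
qed

lemma quad_ints_trace_norm:
  assumes "z \<in> quad_ints d"
  obtains t m where "z + cnj z = of_int t" "z * cnj z = of_int m" "2 * Re z = of_int t" "(cmod z)\<^sup>2 = of_int m"
proof -
  obtain t m where tm: "2 * Re z = of_int t" "(cmod z)\<^sup>2 = of_int m"
    using almost_integral_trace_norm assms unfolding ring_of_integers_iff by (metis Ints_cases)
  moreover have "of_int t = z + cnj z" "of_int m = z * cnj z"
    using tm by (metis complex_add_cnj of_real_of_int_eq, metis complex_norm_square of_real_of_int_eq)
  ultimately show ?thesis using that by metis
qed

text \<open>A denominator common to all integers of the field. For
  \<open>z = a + b * csqrt d\<close> the trace makes \<open>2 * a\<close> an integer; the norm makes
  the square of the rational number \<open>2 * b * d\<close> an integer, hence the number
  itself.\<close>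

lemma quad_ints_conductor:
  assumes "z \<in> quad_ints d" shows "of_int (2 * d) * z \<in> quad_order d"
proof -
  obtain t m where tm: "2 * Re z = of_int t" "(cmod z)\<^sup>2 = of_int m"
    using assms by (rule quad_ints_trace_norm)
  obtain a b where ab: "z = of_real a + of_real b * csqrt (of_int d)" "a \<in> \<rat>" "b \<in> \<rat>"
    using assms unfolding ring_of_integers_def quad_field_def by blast
  have a: "2 * a = of_int t" using tm ab neg by simp
  have "(cmod z)\<^sup>2 = a\<^sup>2 - b\<^sup>2 * of_int d"
    using neg by (simp add: ab(1) cmod_power2 power_mult_distrib)
  hence "of_int m = a\<^sup>2 - b\<^sup>2 * of_int d" using tm by simp
  hence "4 * of_int m = (2 * a)\<^sup>2 - 4 * b\<^sup>2 * of_int d" by (simp add: power_mult_distrib)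
  hence "4 * b\<^sup>2 * of_int d = of_int (t\<^sup>2 - 4 * m)"
    unfolding a by simp
  hence "(4 * b\<^sup>2 * of_int d) * of_int d = of_int ((t\<^sup>2 - 4 * m) * d)"
    by simp
  hence "(2 * b * of_int d)\<^sup>2 = of_int ((t\<^sup>2 - 4 * m) * d)"
    by (simp add: power2_eq_square mult_ac)
  hence "algebraic_int ((2 * b * of_int d)\<^sup>2)"
    by (simp only: algebraic_int_of_int)
  hence "algebraic_int (2 * b * of_int d)"
    by (rule algebraic_int_root[where p = "Polynomial.monom 1 2"]) (auto simp: poly_monom degree_monom_eq)
  hence "2 * b * of_int d \<in> \<int>"
    using ab by (intro rational_algebraic_int_is_int) auto
  then obtain v where v: "2 * b * of_int d = of_int v" by (auto elim: Ints_cases)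
  have "of_int (2 * d) * z = of_real (2 * a) * of_int d + of_real (2 * b * of_int d) * csqrt (of_int d)"
    by (simp add: ab(1) algebra_simps)
  also have "\<dots> = of_int (t * d) + of_int v * csqrt (of_int d)"
    unfolding a v by simp
  finally show ?thesis unfolding quad_order_def by blast
qed

section \<open>Multipliers of ideals, and units\<close>

lemma nonzero_idealsD:
  assumes "I \<in> nonzero_ideals (quad_ints d)"
  shows "I \<subseteq> quad_ints d" "0 \<in> I" "\<And>x y. x \<in> I \<Longrightarrow> y \<in> I \<Longrightarrow> x + y \<in> I"
    "\<And>r x. r \<in> quad_ints d \<Longrightarrow> x \<in> I \<Longrightarrow> r * x \<in> I"
  using assms unfolding nonzero_ideals_def by auto

lemma nonzero_ideals_nonzero:
  assumes "I \<in> nonzero_ideals (quad_ints d)"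
  obtains x where "x \<in> I" "x \<noteq> 0"
  using assms unfolding nonzero_ideals_def by auto

text \<open>Instead of a determinant argument with generators of \<open>I\<close>: the ideal
  contains a nonzero integer \<open>m\<close>, the norm of one of its elements. All
  \<open>b ^ k * m\<close> stay in \<open>I\<close>, so \<open>2 * d * m\<close> is a common
  denominator for the powers of \<open>b\<close>.\<close>

lemma ideal_multiplier_integral:
  assumes I: "I \<in> nonzero_ideals (quad_ints d)" and b: "\<And>x. x \<in> I \<Longrightarrow> b * x \<in> I"
  shows "b \<in> quad_ints d"
proof -
  obtain x where x: "x \<in> I" "x \<noteq> 0" using I by (rule nonzero_ideals_nonzero)
  have "x \<in> quad_ints d" using x nonzero_idealsD[OF I] by auto
  then obtain t m where m: "x * cnj x = of_int m" by (rule quad_ints_trace_norm)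
  have "of_int m \<in> I"
    using m nonzero_idealsD(4)[OF I quad_ints_cnj[OF \<open>x \<in> quad_ints d\<close>] x(1)] by (simp add: mult.commute)
  have "b ^ k * of_int m \<in> I" for k
    by (induction k) (use \<open>of_int m \<in> I\<close> b in \<open>auto simp: mult.assoc\<close>)
  hence "of_int (2 * d) * (b ^ k * of_int m) \<in> quad_order d" for k
    using nonzero_idealsD(1)[OF I] quad_ints_conductor by blast
  hence "of_int (2 * d * m) * b ^ k \<in> quad_order d" for k
    by (simp add: mult_ac)
  moreover have "2 * d * m \<noteq> 0"
    using x m neg by auto
  ultimately show ?thesis
    unfolding ring_of_integers_iff almost_integral_def by blast
qed

text \<open>A unit has norm 1, hence trace \<open>t\<close> with
  \<open>\<bar>t\<bar> \<le> 2\<close>. The five equations \<open>u\<^sup>2 = t * u - 1\<close> have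
  roots of unity of order 1, 2, 3, 4 or 6 as solutions.\<close>

lemma quad_ints_unit_power_12:
  assumes "u \<in> quad_ints d" "inverse u \<in> quad_ints d" "u \<noteq> 0"
  shows "u ^ 12 = 1"
proof -
  obtain t m where u: "u + cnj u = of_int t" "u * cnj u = of_int m" "2 * Re u = of_int t" "(cmod u)\<^sup>2 = of_int m"
    using assms(1) by (rule quad_ints_trace_norm)
  obtain t' m' where u': "(cmod (inverse u))\<^sup>2 = of_int m'"
    using assms(2) by (rule quad_ints_trace_norm)
  have "m > 0" using u(4) assms(3) by (metis of_int_0_less_iff zero_less_norm_iff zero_less_power)
  have "real_of_int (m * m') = (cmod u * cmod (inverse u))\<^sup>2"
    by (simp add: power_mult_distrib u(4) u')
  also have "\<dots> = 1" using assms(3) by (simp add: norm_inverse)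
  finally have "m * m' = 1" by linarith
  hence m: "m = 1" using \<open>m > 0\<close> zmult_eq_1_iff by auto
  have "cmod u = 1" using u(4) m by (simp add: power2_eq_1_iff) (smt (verit) norm_ge_zero)
  hence "\<bar>2 * Re u\<bar> \<le> 2" using abs_Re_le_cmod[of u] by simp
  hence "\<bar>t\<bar> \<le> 2" using u(3) by linarith
  have "of_int t * u = u\<^sup>2 + u * cnj u"
    unfolding u(1)[symmetric] by (simp add: algebra_simps power2_eq_square)
  hence quad: "u\<^sup>2 = of_int t * u - 1"
    using u(2) m by simp
  \<comment> \<open>The power is arranged around the cube of \<open>u\<close>, which is 1 for trace
    -1 and -1 for trace 1.\<close>
  have pow: "u ^ 12 = ((u\<^sup>2 * u)\<^sup>2)\<^sup>2" by (simp add: eval_nat_numeral)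
  consider "t = -2" | "t = -1" | "t = 0" | "t = 1" | "t = 2" using \<open>\<bar>t\<bar> \<le> 2\<close> by linarith
  thus ?thesis
  proof cases
    case 1
    hence "(u + 1)\<^sup>2 = 0" using quad by (simp add: power2_sum)
    hence "u = -1" by (simp add: add_eq_0_iff2)
    thus ?thesis by simp
  next
    case 2
    have "u\<^sup>2 * u = - u\<^sup>2 - u" by (subst quad) (simp add: 2 algebra_simps power2_eq_square)
    also have "\<dots> = 1" using quad 2 by simp
    finally show ?thesis unfolding pow by simp
  next
    case 3
    have "u ^ 12 = (u\<^sup>2) ^ 6" by (simp flip: power_mult)
    thus ?thesis using quad 3 by simp
  next
    case 4
    have "u\<^sup>2 * u = u\<^sup>2 - u" by (subst quad) (simp add: 4 algebra_simps power2_eq_square)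
    also have "\<dots> = -1" using quad 4 by simp
    finally show ?thesis unfolding pow by simp
  next
    case 5
    hence "(u - 1)\<^sup>2 = 0" using quad by (simp add: power2_diff)
    hence "u = 1" by simp
    thus ?thesis by simp
  qed
qed

end

subsection \<open>Divisibility of the class number\<close>

lemma funpow_fixed: "f x = x \<Longrightarrow> (f ^^ k) x = x"
  by (induction k) auto

text \<open>A Bezout identity with natural coefficients, \<open>a * u = b * v + gcd a b\<close>,
  avoids inverting \<open>f\<close>.\<close>

lemma funpow_fixed_gcd:
  assumes "(f ^^ a) x = x" "(f ^^ b) x = x"
  shows "(f ^^ gcd a b) x = x"
proof (cases "a = 0")
  case False
  then obtain u v where uv: "a * u = b * v + gcd a b"
    using bezout_nat by blast
  have "x = (f ^^ (a * u)) x"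
    using funpow_fixed[of "f ^^ a" x u] assms(1) by (simp add: funpow_mult)
  also have "\<dots> = (f ^^ gcd a b) ((f ^^ (b * v)) x)"
    unfolding uv by (subst add.commute) (simp add: funpow_add)
  also have "(f ^^ (b * v)) x = x"
    using funpow_fixed[of "f ^^ b" x v] assms(2) by (simp add: funpow_mult)
  finally show ?thesis by simp
qed (use assms in auto)

text \<open>The orbits partition \<open>X\<close>, and each has \<open>n\<close> elements: a
  coincidence of the iterates \<open>i < j < n\<close> would make \<open>x\<close> fixed under
  \<open>j - i\<close> steps, hence under \<open>gcd (j - i) n\<close> steps, a proper divisor of
  \<open>n\<close>.\<close>

lemma dvd_card_if_orbits_full:
  assumes "finite X" "n > 0" and closed: "\<And>x. x \<in> X \<Longrightarrow> f x \<in> X"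
    and period: "\<And>x. x \<in> X \<Longrightarrow> (f ^^ n) x = x"
    and minimal: "\<And>x e. x \<in> X \<Longrightarrow> e dvd n \<Longrightarrow> e < n \<Longrightarrow> (f ^^ e) x \<noteq> x"
  shows "n dvd card X"
proof -
  define orb where "orb x = (\<lambda>i. (f ^^ i) x) ` {..<n}" for x
  have closed': "(f ^^ i) x \<in> X" if "x \<in> X" for i x
    using that closed by (induction i) auto
  have mem: "(f ^^ i) x \<in> orb x" if "x \<in> X" for x i
  proof -
    have "(f ^^ i) x = (f ^^ (i mod n)) x"
      using period[OF that] by (simp add: funpow_mod_eq)
    thus ?thesis unfolding orb_def using \<open>n > 0\<close> by auto
  qed
  have orb_eq: "orb x = orb y" if "x \<in> X" "y \<in> orb x" for x y
  proof -
    obtain i where i: "y = (f ^^ i) x" using \<open>y \<in> orb x\<close> unfolding orb_def by blast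
    have y: "y \<in> X" using closed' that i by simp
    \<comment> \<open>These further steps complete \<open>i\<close> to the multiple
      \<open>n * i\<close> of the period, so they lead back from \<open>y\<close> to
      \<open>x\<close>.\<close>
    have "(f ^^ ((n - 1) * i)) y = (f ^^ (n * i)) x"
      using \<open>n > 0\<close> unfolding i by (cases n) (simp_all add: add.commute flip: funpow_add comp_apply[of "f ^^ _" "f ^^ _"])
    also have "\<dots> = x" using funpow_fixed[of "f ^^ n" x i] period[OF \<open>x \<in> X\<close>] by (simp add: funpow_mult)
    finally have x: "(f ^^ ((n - 1) * i)) y = x" .
    have mem': "(f ^^ j) ((f ^^ i) x) \<in> orb x" if "x \<in> X" for i j x
      using mem[OF that, of "j + i"] by (simp add: funpow_add)
    have "orb y \<subseteq> orb x"
      using mem'[OF \<open>x \<in> X\<close>] unfolding i orb_def[of "(f ^^ i) x"] by blast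
    moreover have "orb x \<subseteq> orb y"
    proof
      fix z assume "z \<in> orb x"
      then obtain j where "z = (f ^^ j) x" unfolding orb_def by blast
      thus "z \<in> orb y" using mem'[OF y, of j "(n - 1) * i"] unfolding x by simp
    qed
    ultimately show ?thesis by blast
  qed
  have shift: "(f ^^ (j - i)) x = x" if "x \<in> X" "i \<le> j" "j < n" "(f ^^ i) x = (f ^^ j) x" for x i j
  proof -
    have "(f ^^ (n - i)) ((f ^^ i) x) = x"
    proof -
      have "n - i + i = n" using that by simp
      thus ?thesis using period[OF that(1)] by (simp flip: funpow_add comp_apply[of "f ^^ _" "f ^^ _"])
    qed
    moreover have "(f ^^ (n - i)) ((f ^^ j) x) = (f ^^ (j - i)) ((f ^^ n) x)"
    proof -
      have "n - i + j = j - i + n" using that by simp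
      thus ?thesis by (simp flip: funpow_add comp_apply[of "f ^^ _" "f ^^ _"])
    qed
    ultimately show ?thesis using that(4) period[OF that(1)] by simp
  qed
  have inj: "inj_on (\<lambda>i. (f ^^ i) x) {..<n}" if "x \<in> X" for x
  proof (rule linorder_inj_onI)
    fix i j :: nat assume ij: "i < j" "i \<in> {..<n}" "j \<in> {..<n}"
    show "(f ^^ i) x \<noteq> (f ^^ j) x"
    proof
      assume "(f ^^ i) x = (f ^^ j) x"
      hence "(f ^^ (j - i)) x = x" using shift[OF that] ij by auto
      hence "(f ^^ gcd (j - i) n) x = x"
        using funpow_fixed_gcd period[OF that] by metis
      moreover have "gcd (j - i) n < n"
        using ij by (intro le_less_trans[OF gcd_le1_nat]) auto
      ultimately show False using minimal[OF that] by auto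
    qed
  qed auto
  have "n * card (orb ` X) = card (\<Union> (orb ` X))"
  proof (rule card_partition)
    show "c1 \<inter> c2 = {}" if c: "c1 \<in> orb ` X" "c2 \<in> orb ` X" "c1 \<noteq> c2" for c1 c2
    proof -
      obtain x y where "x \<in> X" "y \<in> X" "c1 = orb x" "c2 = orb y" using c by blast
      thus ?thesis using orb_eq[of x] orb_eq[of y] c(3) by blast
    qed
    show "card c = n" if "c \<in> orb ` X" for c
      using that card_image[OF inj] by (auto simp: orb_def)
  qed (use assms(1) in \<open>auto simp: orb_def\<close>)
  also have "\<Union> (orb ` X) = X"
    using closed' mem[where i = 0] by (auto simp: orb_def)
  finally show ?thesis by (metis dvd_triv_left)
qed

text \<open>Nothing is claimed here for an infinite quotient, whose \<open>card\<close> is \<open>0\<close>; hence the finiteness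
  of the class number is never needed.\<close>

lemma dvd_card_quotient_if_orbits_full:
  assumes r: "equiv A r" and "n > 0"
    and closed: "\<And>x. x \<in> A \<Longrightarrow> T x \<in> A"
    and compat: "\<And>x y. (x, y) \<in> r \<Longrightarrow> (T x, T y) \<in> r"
    and period: "\<And>x. x \<in> A \<Longrightarrow> ((T ^^ n) x, x) \<in> r"
    and minimal: "\<And>x e. x \<in> A \<Longrightarrow> e dvd n \<Longrightarrow> e < n \<Longrightarrow> ((T ^^ e) x, x) \<notin> r"
  shows "n dvd card (A // r)"
proof (cases "finite (A // r)")
  case True
  \<comment> \<open>The map induced by \<open>T\<close> on classes, evaluated at a chosen
    representative; \<open>compat\<close> makes the choice irrelevant.\<close>
  define F where "F C = r `` {T (SOME x. x \<in> C)}" for C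
  have F: "F (r `` {x}) = r `` {T x}" if "x \<in> A" for x
  proof -
    have "(SOME y. y \<in> r `` {x}) \<in> r `` {x}"
      using equiv_class_self[OF r that] by (rule someI)
    thus ?thesis unfolding F_def using compat equiv_class_eq[OF r] by blast
  qed
  have closed': "(T ^^ i) x \<in> A" if "x \<in> A" for i x
    using that closed by (induction i) auto
  have Fk: "(F ^^ k) (r `` {x}) = r `` {(T ^^ k) x}" if "x \<in> A" for x k
    by (induction k) (use F closed'[OF that] in auto)
  show ?thesis
  proof (rule dvd_card_if_orbits_full[OF True \<open>n > 0\<close>, where f = F])
    fix C assume "C \<in> A // r"
    then obtain x where x: "x \<in> A" "C = r `` {x}" by (auto elim: quotientE)
    show "F C \<in> A // r" using F x closed by (auto intro: quotientI)
    show "(F ^^ n) C = C"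
      using Fk x period equiv_class_eq[OF r] by auto
    show "(F ^^ e) C \<noteq> C" if "e dvd n" "e < n" for e
      using Fk x minimal[OF x(1) that] eq_equiv_class[OF _ r x(1)] by auto
  qed
qed simp

section \<open>Power sums as polynomials in the norm\<close>

text \<open>The Lucas sequence of the second kind with trace \<open>t\<close>, as a polynomial in the norm.\<close>

fun lucas_poly :: "int \<Rightarrow> nat \<Rightarrow> int poly" where
  "lucas_poly t 0 = [:2:]"
| "lucas_poly t (Suc 0) = [:t:]"
| "lucas_poly t (Suc (Suc k)) = Polynomial.smult t (lucas_poly t (Suc k)) - pCons 0 (lucas_poly t k)"

lemma lucas_poly_power_sum:
  fixes z w :: "'a :: comm_ring_1"
  assumes "z + w = of_int t" "z * w = of_int m"
  shows "of_int (poly (lucas_poly t k) m) = z ^ k + w ^ k"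
proof (induction k rule: induct_nat_012)
  case (ge2 k)
  have "of_int (poly (lucas_poly t (Suc (Suc k))) m) =
      of_int t * (z ^ Suc k + w ^ Suc k) - of_int m * (z ^ k + w ^ k)"
    by (simp add: ge2 del: power_Suc)
  also have "\<dots> = z ^ Suc (Suc k) + w ^ Suc (Suc k)"
    unfolding assms[symmetric] by (simp add: algebra_simps)
  finally show ?case .
qed (use assms in auto)

text \<open>The recurrence turns an odd-index value into a multiple of \<open>t\<close> minus
  \<open>m\<close> times the previous odd-index value. This later confines the trace to the divisors
  of \<open>2 * q\<close>.\<close>

lemma dvd_poly_lucas_poly: "t dvd poly (lucas_poly t (2 * i + 1)) m"
  by (induction i) auto

text \<open>Even and odd indices are handled together because the recurrence couples their leading
  coefficients. The degrees are only bounded, since the odd coefficient vanishes for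
  \<open>t = 0\<close>.\<close>

lemma lucas_poly_lead:
  "degree (lucas_poly t (2 * i)) \<le> i \<and> Polynomial.coeff (lucas_poly t (2 * i)) i = 2 * (-1) ^ i \<and>
   degree (lucas_poly t (2 * i + 1)) \<le> i \<and>
   Polynomial.coeff (lucas_poly t (2 * i + 1)) i = (-1) ^ i * (2 * int i + 1) * t"
proof (induction i)
  case (Suc i)
  have e: "lucas_poly t (2 * Suc i) = Polynomial.smult t (lucas_poly t (2 * i + 1)) - pCons 0 (lucas_poly t (2 * i))"
    "lucas_poly t (2 * Suc i + 1) = Polynomial.smult t (lucas_poly t (2 * Suc i)) - pCons 0 (lucas_poly t (2 * i + 1))"
    by simp_all
  have d1: "degree (lucas_poly t (2 * Suc i)) \<le> Suc i"
    unfolding e(1) using Suc by (intro degree_diff_le order_trans[OF degree_smult_le] order_trans[OF degree_pCons_le]) auto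
  have c1: "Polynomial.coeff (lucas_poly t (2 * Suc i)) (Suc i) = 2 * (-1) ^ Suc i"
    unfolding e(1) using Suc by (simp add: coeff_eq_0)
  have d2: "degree (lucas_poly t (2 * Suc i + 1)) \<le> Suc i"
    unfolding e(2) using Suc d1 by (intro degree_diff_le order_trans[OF degree_smult_le] order_trans[OF degree_pCons_le]) auto
  have "Polynomial.coeff (lucas_poly t (2 * Suc i + 1)) (Suc i) = (-1) ^ Suc i * (2 * int (Suc i) + 1) * t"
    unfolding e(2) using Suc c1 by (simp add: algebra_simps)
  thus ?case using d1 c1 d2 by blast
qed auto

lemma finite_poly_lucas_poly_eq:
  assumes "t \<noteq> 0" "i > 0"
  shows "finite {m. poly (lucas_poly t (2 * i + 1)) m = c}"
proof -
  define P where "P = lucas_poly t (2 * i + 1) - [:c:]"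
  have "Polynomial.coeff P i = (-1) ^ i * (2 * int i + 1) * t"
    using lucas_poly_lead[of t i] assms by (simp add: P_def coeff_pCons split: nat.splits)
  hence "P \<noteq> 0" using assms by auto
  hence "finite {m. poly P m = 0}" by (rule poly_roots_finite)
  thus ?thesis by (simp add: P_def)
qed

section \<open>Multiplication of ideals and classes by \<open>(P, \<alpha>)\<close>\<close>

text \<open>This is the product of \<open>I\<close> with the ideal generated by \<open>P\<close> and \<open>\<alpha>\<close>; multiplying by
  such an ideal is all that is needed of ideal multiplication.\<close>

definition lin_ideal :: "int \<Rightarrow> complex \<Rightarrow> complex set \<Rightarrow> complex set" where
  "lin_ideal P \<alpha> I = {of_int P * x + \<alpha> * y | x y. x \<in> I \<and> y \<in> I}"

lemma lin_ideal_scale: "lin_ideal P \<alpha> ((*) c ` I) = (*) c ` lin_ideal P \<alpha> I"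
proof
  show "lin_ideal P \<alpha> ((*) c ` I) \<subseteq> (*) c ` lin_ideal P \<alpha> I"
  proof
    fix z assume "z \<in> lin_ideal P \<alpha> ((*) c ` I)"
    then obtain x y where "x \<in> I" "y \<in> I" "z = of_int P * (c * x) + \<alpha> * (c * y)"
      unfolding lin_ideal_def by blast
    moreover from this have "z = c * (of_int P * x + \<alpha> * y)" by (simp add: algebra_simps)
    ultimately show "z \<in> (*) c ` lin_ideal P \<alpha> I" unfolding lin_ideal_def by blast
  qed
  show "(*) c ` lin_ideal P \<alpha> I \<subseteq> lin_ideal P \<alpha> ((*) c ` I)"
  proof
    fix z assume "z \<in> (*) c ` lin_ideal P \<alpha> I"
    then obtain x y where "x \<in> I" "y \<in> I" "z = c * (of_int P * x + \<alpha> * y)"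
      unfolding lin_ideal_def by blast
    moreover from this have "z = of_int P * (c * x) + \<alpha> * (c * y)" by (simp add: algebra_simps)
    ultimately show "z \<in> lin_ideal P \<alpha> ((*) c ` I)" unfolding lin_ideal_def by blast
  qed
qed

lemma funpow_lin_ideal_scale: "(lin_ideal P \<alpha> ^^ k) ((*) c ` I) = (*) c ` (lin_ideal P \<alpha> ^^ k) I"
  by (induction k) (simp_all add: lin_ideal_scale)

context
  fixes d :: int
  assumes neg: "d < 0"
begin

lemma equiv_ideal_class_rel: "equiv (nonzero_ideals (quad_ints d)) (ideal_class_rel (quad_ints d))"
proof (rule equivI)
  show "refl_on (nonzero_ideals (quad_ints d)) (ideal_class_rel (quad_ints d))"
  proof (rule refl_onI)
    fix I assume "I \<in> nonzero_ideals (quad_ints d)"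
    moreover have "1 \<in> quad_ints d - {0}" using quad_ints_1[OF neg] by simp
    ultimately show "(I, I) \<in> ideal_class_rel (quad_ints d)"
      unfolding ideal_class_rel_def by blast
  qed
  show "sym (ideal_class_rel (quad_ints d))"
  proof (rule symI)
    fix I J assume "(I, J) \<in> ideal_class_rel (quad_ints d)"
    then obtain a b where "I \<in> nonzero_ideals (quad_ints d)" "J \<in> nonzero_ideals (quad_ints d)"
      "a \<in> quad_ints d - {0}" "b \<in> quad_ints d - {0}" "(*) b ` J = (*) a ` I"
      unfolding ideal_class_rel_def by fastforce
    thus "(J, I) \<in> ideal_class_rel (quad_ints d)"
      unfolding ideal_class_rel_def by blast
  qed
  show "trans (ideal_class_rel (quad_ints d))"
  proof (rule transI)
    fix I J K assume "(I, J) \<in> ideal_class_rel (quad_ints d)" "(J, K) \<in> ideal_class_rel (quad_ints d)"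
    then obtain a b c e where *: "I \<in> nonzero_ideals (quad_ints d)" "K \<in> nonzero_ideals (quad_ints d)"
      "a \<in> quad_ints d - {0}" "b \<in> quad_ints d - {0}" "c \<in> quad_ints d - {0}" "e \<in> quad_ints d - {0}"
      "(*) a ` I = (*) b ` J" "(*) c ` J = (*) e ` K"
      unfolding ideal_class_rel_def by clarsimp metis
    have "(*) (c * a) ` I = (*) c ` (*) a ` I" by (simp add: image_image mult.assoc)
    also have "\<dots> = (*) b ` (*) c ` J" unfolding *(7) by (simp add: image_image mult_ac)
    also have "\<dots> = (*) (b * e) ` K" unfolding *(8) by (simp add: image_image mult.assoc)
    finally have "(*) (c * a) ` I = (*) (b * e) ` K" .
    moreover have "c * a \<in> quad_ints d - {0}" "b * e \<in> quad_ints d - {0}" using * quad_ints_mult[OF neg] by auto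
    ultimately show "(I, K) \<in> ideal_class_rel (quad_ints d)" using * unfolding ideal_class_rel_def by blast
  qed
  show "ideal_class_rel (quad_ints d) \<subseteq> nonzero_ideals (quad_ints d) \<times> nonzero_ideals (quad_ints d)"
    unfolding ideal_class_rel_def by blast
qed

lemma lin_ideal_subset:
  assumes I: "I \<in> nonzero_ideals (quad_ints d)" and "\<alpha> \<in> quad_ints d"
  shows "lin_ideal P \<alpha> I \<subseteq> I"
  unfolding lin_ideal_def using nonzero_idealsD[OF neg I] assms quad_ints_of_int[OF neg] by auto

lemma lin_ideal_nonzero_ideals:
  assumes I: "I \<in> nonzero_ideals (quad_ints d)" and "P \<noteq> 0" "\<alpha> \<in> quad_ints d"
  shows "lin_ideal P \<alpha> I \<in> nonzero_ideals (quad_ints d)"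
proof -
  note D = nonzero_idealsD[OF neg I]
  have uminus: "\<And>x. x \<in> I \<Longrightarrow> - x \<in> I" using I unfolding nonzero_ideals_def by blast
  have sub: "lin_ideal P \<alpha> I \<subseteq> I"
    using I \<open>\<alpha> \<in> quad_ints d\<close> by (rule lin_ideal_subset)
  obtain x where x: "x \<in> I" "x \<noteq> 0" using I by (rule nonzero_ideals_nonzero[OF neg])
  have "of_int P * x + \<alpha> * 0 \<in> lin_ideal P \<alpha> I" "of_int P * x + \<alpha> * 0 \<noteq> 0"
    using x D(2) \<open>P \<noteq> 0\<close> unfolding lin_ideal_def by (blast, simp)
  moreover have "of_int P * 0 + \<alpha> * 0 \<in> lin_ideal P \<alpha> I"
    using D(2) unfolding lin_ideal_def by blast
  moreover have "u + v \<in> lin_ideal P \<alpha> I" if uv: "u \<in> lin_ideal P \<alpha> I" "v \<in> lin_ideal P \<alpha> I" for u v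
  proof -
    obtain x y x' y' where xy: "x \<in> I" "y \<in> I" "x' \<in> I" "y' \<in> I"
      "u = of_int P * x + \<alpha> * y" "v = of_int P * x' + \<alpha> * y'"
      using uv unfolding lin_ideal_def by blast
    hence "u + v = of_int P * (x + x') + \<alpha> * (y + y')" by (simp add: algebra_simps)
    thus ?thesis using xy D(3) unfolding lin_ideal_def by blast
  qed
  moreover have "- u \<in> lin_ideal P \<alpha> I" if u: "u \<in> lin_ideal P \<alpha> I" for u
  proof -
    obtain x y where xy: "x \<in> I" "y \<in> I" "u = of_int P * x + \<alpha> * y"
      using u unfolding lin_ideal_def by blast
    hence "- u = of_int P * (- x) + \<alpha> * (- y)" by (simp add: algebra_simps)
    thus ?thesis using xy uminus unfolding lin_ideal_def by blast
  qed
  moreover have "r * u \<in> lin_ideal P \<alpha> I" if u: "r \<in> quad_ints d" "u \<in> lin_ideal P \<alpha> I" for r u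
  proof -
    obtain x y where xy: "x \<in> I" "y \<in> I" "u = of_int P * x + \<alpha> * y"
      using u unfolding lin_ideal_def by blast
    hence "r * u = of_int P * (r * x) + \<alpha> * (r * y)" by (simp add: algebra_simps)
    thus ?thesis using xy D(4) u(1) unfolding lin_ideal_def by blast
  qed
  ultimately show ?thesis
    unfolding nonzero_ideals_def using sub D(1) by auto
qed

lemma ideal_class_rel_lin_ideal:
  assumes "(I, J) \<in> ideal_class_rel (quad_ints d)" "P \<noteq> 0" "\<alpha> \<in> quad_ints d"
  shows "(lin_ideal P \<alpha> I, lin_ideal P \<alpha> J) \<in> ideal_class_rel (quad_ints d)"
proof -
  obtain a b where *: "I \<in> nonzero_ideals (quad_ints d)" "J \<in> nonzero_ideals (quad_ints d)"
      "a \<in> quad_ints d - {0}" "b \<in> quad_ints d - {0}" "(*) a ` I = (*) b ` J"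
    using assms(1) unfolding ideal_class_rel_def by blast
  have "(*) a ` lin_ideal P \<alpha> I = (*) b ` lin_ideal P \<alpha> J"
    unfolding lin_ideal_scale[symmetric] *(5) ..
  moreover have "lin_ideal P \<alpha> I \<in> nonzero_ideals (quad_ints d)" "lin_ideal P \<alpha> J \<in> nonzero_ideals (quad_ints d)"
    using * lin_ideal_nonzero_ideals assms(2,3) by auto
  ultimately show ?thesis using *(3,4) unfolding ideal_class_rel_def by blast
qed

section \<open>Powers of the ideal \<open>(p, \<alpha>)\<close> and short orbits\<close>

context
  fixes n :: nat and p s :: int and \<alpha> :: complex
  assumes p: "p > 0" and cop: "coprime p s"
    and alpha: "\<alpha> \<in> quad_ints d" and norm: "\<alpha> * cnj \<alpha> = of_int (p ^ n)" and trace: "\<alpha> + cnj \<alpha> = of_int s"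
begin

text \<open>In terms of ideals,
  \<open>(p, \<alpha>) (p ^ j, \<alpha>) = (p ^ (j + 1), \<alpha>)\<close>. The point is that
  \<open>\<alpha>\<close> lies in the product: by coprimality it is a combination of
  \<open>p * \<alpha>\<close> and \<open>s * \<alpha>\<close>, and
  \<open>s * \<alpha> = \<alpha> * \<alpha> + p ^ n\<close>, where \<open>p ^ (j + 1)\<close>
  divides \<open>p ^ n\<close>.\<close>

lemma lin_ideal_comp:
  assumes I: "I \<in> nonzero_ideals (quad_ints d)" and j: "j < n"
  shows "lin_ideal p \<alpha> (lin_ideal (p ^ j) \<alpha> I) = lin_ideal (p ^ Suc j) \<alpha> I"
proof
  note D = nonzero_idealsD[OF neg I]
  note closed = D(3) D(4)[OF quad_ints_of_int[OF neg]] D(4)[OF alpha]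
  show "lin_ideal p \<alpha> (lin_ideal (p ^ j) \<alpha> I) \<subseteq> lin_ideal (p ^ Suc j) \<alpha> I"
  proof
    fix z assume "z \<in> lin_ideal p \<alpha> (lin_ideal (p ^ j) \<alpha> I)"
    then obtain x y x' y' where xy: "x \<in> I" "y \<in> I" "x' \<in> I" "y' \<in> I"
      "z = of_int p * (of_int (p ^ j) * x + \<alpha> * y) + \<alpha> * (of_int (p ^ j) * x' + \<alpha> * y')"
      unfolding lin_ideal_def by blast
    hence "z = of_int (p ^ Suc j) * x + \<alpha> * (of_int p * y + (of_int (p ^ j) * x' + \<alpha> * y'))"
      by (simp add: algebra_simps)
    moreover have "of_int p * y + (of_int (p ^ j) * x' + \<alpha> * y') \<in> I"
      using xy by (intro closed)
    ultimately show "z \<in> lin_ideal (p ^ Suc j) \<alpha> I"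
      using xy unfolding lin_ideal_def by blast
  qed
  show "lin_ideal (p ^ Suc j) \<alpha> I \<subseteq> lin_ideal p \<alpha> (lin_ideal (p ^ j) \<alpha> I)"
  proof
    fix z assume "z \<in> lin_ideal (p ^ Suc j) \<alpha> I"
    then obtain x y where xy: "x \<in> I" "y \<in> I" "z = of_int (p ^ Suc j) * x + \<alpha> * y"
      unfolding lin_ideal_def by blast
    obtain u v where uv: "u * p + v * s = 1"
      using cop bezout_int[of p s] by auto
    \<comment> \<open>The term \<open>v * p ^ n * y\<close> equals
      \<open>p ^ (j + 1) * w\<close>.\<close>
    define w where "w = of_int (p ^ (n - Suc j)) * (of_int v * y)"
    have pn: "of_int p ^ n = (of_int p * of_int p ^ j * of_int p ^ (n - Suc j) :: complex)"
      using j by (simp flip: power_add power_Suc)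
    have "\<alpha> * y = of_int (u * p + v * s) * \<alpha> * y" unfolding uv by simp
    also have "\<dots> = of_int p * \<alpha> * (of_int u * y) + of_int v * (\<alpha> * (\<alpha> + cnj \<alpha>)) * y"
      unfolding trace by (simp add: algebra_simps)
    also have "\<alpha> * (\<alpha> + cnj \<alpha>) = \<alpha> * \<alpha> + of_int p ^ n"
      using norm by (simp add: algebra_simps)
    also have "of_int p * \<alpha> * (of_int u * y) + of_int v * (\<alpha> * \<alpha> + of_int p ^ n) * y =
        of_int p * (of_int (p ^ j) * w + \<alpha> * (of_int u * y)) + \<alpha> * (of_int (p ^ j) * 0 + \<alpha> * (of_int v * y))"
      unfolding w_def pn by (simp add: algebra_simps)
    finally have "z = of_int p * (of_int (p ^ j) * (x + w) + \<alpha> * (of_int u * y)) + \<alpha> * (of_int (p ^ j) * 0 + \<alpha> * (of_int v * y))"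
      unfolding xy(3) by (simp add: algebra_simps)
    moreover have "x + w \<in> I" "of_int u * y \<in> I" "of_int v * y \<in> I"
      unfolding w_def of_int_power[symmetric] using xy by (auto intro!: closed simp del: of_int_power)
    ultimately show "z \<in> lin_ideal p \<alpha> (lin_ideal (p ^ j) \<alpha> I)"
      using D(2) unfolding lin_ideal_def by blast
  qed
qed

lemma funpow_lin_ideal:
  assumes I: "I \<in> nonzero_ideals (quad_ints d)" and j: "0 < j" "j \<le> n"
  shows "(lin_ideal p \<alpha> ^^ j) I = lin_ideal (p ^ j) \<alpha> I"
  using j
proof (induction j rule: nat_induct_non_zero)
  case (Suc j)
  thus ?case using lin_ideal_comp[OF I, of j] by simp
qed simp

text \<open>As \<open>p ^ n = \<alpha> * cnj \<alpha>\<close>, the ideal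
  \<open>(p ^ n, \<alpha>)\<close> is just \<open>(\<alpha>)\<close>.\<close>

lemma funpow_lin_ideal_n:
  assumes I: "I \<in> nonzero_ideals (quad_ints d)" and "n > 0"
  shows "(lin_ideal p \<alpha> ^^ n) I = (*) \<alpha> ` I"
proof -
  note D = nonzero_idealsD[OF neg I]
  have "lin_ideal (p ^ n) \<alpha> I = (*) \<alpha> ` I"
  proof
    show "lin_ideal (p ^ n) \<alpha> I \<subseteq> (*) \<alpha> ` I"
    proof
      fix z assume "z \<in> lin_ideal (p ^ n) \<alpha> I"
      then obtain x y where xy: "x \<in> I" "y \<in> I" "z = of_int (p ^ n) * x + \<alpha> * y"
        unfolding lin_ideal_def by blast
      hence "z = \<alpha> * (cnj \<alpha> * x + y)" unfolding norm[symmetric] by (simp add: algebra_simps)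
      moreover have "cnj \<alpha> * x + y \<in> I" using xy D(3) D(4)[OF quad_ints_cnj[OF neg alpha]] by auto
      ultimately show "z \<in> (*) \<alpha> ` I" by blast
    qed
    show "(*) \<alpha> ` I \<subseteq> lin_ideal (p ^ n) \<alpha> I"
    proof
      fix z assume "z \<in> (*) \<alpha> ` I"
      then obtain y where "y \<in> I" "z = of_int (p ^ n) * 0 + \<alpha> * y" by auto
      thus "z \<in> lin_ideal (p ^ n) \<alpha> I" using D(2) unfolding lin_ideal_def by blast
    qed
  qed
  thus ?thesis using funpow_lin_ideal[OF I \<open>n > 0\<close>] by simp
qed

lemma alpha_nonzero: "\<alpha> \<noteq> 0"
  using norm p by auto

lemma fixed_class_imp_root:
  assumes I: "I \<in> nonzero_ideals (quad_ints d)" and e: "e dvd n" "e < n" and n: "odd n" "\<not> 3 dvd n"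
    and fixed: "((lin_ideal p \<alpha> ^^ e) I, I) \<in> ideal_class_rel (quad_ints d)"
  obtains z where "z \<in> quad_ints d" "z ^ (n div e) = \<alpha>"
proof -
  define T where "T = lin_ideal p \<alpha>"
  define k where "k = n div e"
  have k: "n = e * k" using e by (simp add: k_def)
  have "n > 0" using n by (auto intro: Nat.gr0I)
  hence "e > 0" "k > 0" using k by auto
  obtain a b where ab: "a \<in> quad_ints d" "a \<noteq> 0" "b \<in> quad_ints d" "b \<noteq> 0" "(*) a ` (T ^^ e) I = (*) b ` I"
    using fixed unfolding ideal_class_rel_def T_def by blast
  \<comment> \<open>So far \<open>c\<close> is only a fraction. It becomes an integer below because
    \<open>(T ^^ e) I = c I\<close> is contained in \<open>I\<close>.\<close>
  define c where "c = b / a"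
  have "(T ^^ e) I = (*) (inverse a) ` (*) a ` (T ^^ e) I"
    using ab(2) by (simp add: image_image flip: mult.assoc)
  also have "\<dots> = (*) c ` I" unfolding ab(5) by (simp add: image_image c_def field_simps)
  finally have Te: "(T ^^ e) I = (*) c ` I" .
  have "c \<noteq> 0" using ab by (simp add: c_def)
  have "(T ^^ (e * j)) I = (*) (c ^ j) ` I" for j
  proof (induction j)
    case (Suc j)
    have "(T ^^ (e * Suc j)) I = (T ^^ e) ((T ^^ (e * j)) I)"
      by (simp add: funpow_add)
    also have "\<dots> = (*) (c ^ j) ` (*) c ` I"
      unfolding Suc unfolding T_def funpow_lin_ideal_scale unfolding Te[unfolded T_def] ..
    finally show ?case by (simp add: image_image mult_ac)
  qed simp
  from this[of k] have ck: "(*) (c ^ k) ` I = (*) \<alpha> ` I"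
    using funpow_lin_ideal_n[OF I \<open>n > 0\<close>] k by (simp add: T_def)
  have "(T ^^ e) I \<subseteq> I"
    using lin_ideal_subset[OF I alpha] funpow_lin_ideal[OF I \<open>e > 0\<close>] e by (simp add: T_def)
  hence "c * x \<in> I" if "x \<in> I" for x using that Te by blast
  hence c: "c \<in> quad_ints d" by (rule ideal_multiplier_integral[OF neg I])
  \<comment> \<open>Both \<open>u\<close> and its inverse map \<open>I\<close> into itself, by the
    two descriptions of \<open>(T ^^ n) I\<close>; hence \<open>u\<close> is a unit.\<close>
  define u where "u = c ^ k / \<alpha>"
  have "u \<noteq> 0" using \<open>c \<noteq> 0\<close> alpha_nonzero by (simp add: u_def)
  have u1: "u * x \<in> I" if "x \<in> I" for x
  proof -
    have "c ^ k * x \<in> (*) \<alpha> ` I" using that ck by blast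
    then obtain y where "y \<in> I" "c ^ k * x = \<alpha> * y" by blast
    thus ?thesis using alpha_nonzero by (simp add: u_def)
  qed
  have u2: "inverse u * x \<in> I" if "x \<in> I" for x
  proof -
    have "\<alpha> * x \<in> (*) (c ^ k) ` I" using that ck by blast
    then obtain y where "y \<in> I" "\<alpha> * x = c ^ k * y" by blast
    thus ?thesis using \<open>c \<noteq> 0\<close> by (simp add: u_def)
  qed
  have u: "u \<in> quad_ints d" "inverse u \<in> quad_ints d"
    using u1 u2 by (auto intro: ideal_multiplier_integral[OF neg I])
  have "u ^ 12 = 1" using u \<open>u \<noteq> 0\<close> by (rule quad_ints_unit_power_12[OF neg])
  \<comment> \<open>Being prime to 6, \<open>k\<close> is its own inverse modulo 12. Thus
    \<open>u = (u ^ k) ^ k\<close> is itself a \<open>k\<close>-th power and can be divided out of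
    \<open>c ^ k\<close>.\<close>
  have "odd k" "\<not> 3 dvd k" using n k by auto
  hence "k mod 12 \<in> {1, 5, 7, 11}" by (simp add: set_eq_iff) presburger
  hence "k * k mod 12 = 1"
    by (subst mod_mult_eq[symmetric]) auto
  then obtain j where j: "k * k = 12 * j + 1" by (metis mult_div_mod_eq)
  have uk: "u ^ (k * k) = u" unfolding j using \<open>u ^ 12 = 1\<close> by (simp add: power_mult)
  define z where "z = c * inverse u ^ k"
  have "z ^ k = c ^ k * inverse (u ^ (k * k))"
    by (simp add: z_def power_mult_distrib power_inverse flip: power_mult)
  also have "\<dots> = \<alpha>" unfolding uk using \<open>c \<noteq> 0\<close> by (simp add: u_def)
  finally have "z ^ k = \<alpha>" .
  moreover have "z \<in> quad_ints d" unfolding z_def using c u by (intro quad_ints_mult quad_ints_power neg)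
  ultimately show ?thesis using that k_def by blast
qed

text \<open>Taking norms in \<open>z ^ k = \<alpha>\<close> gives
  \<open>m ^ k = (p ^ e) ^ k\<close>, so the norm of \<open>z\<close> is \<open>p ^ e\<close>;
  taking traces gives the power sum \<open>s\<close>.\<close>

lemma fixed_class_imp_lucas:
  assumes "I \<in> nonzero_ideals (quad_ints d)" and e: "e dvd n" "e < n" and n: "odd n" "\<not> 3 dvd n"
    and "((lin_ideal p \<alpha> ^^ e) I, I) \<in> ideal_class_rel (quad_ints d)"
  obtains t i where "e > 0" "i > 0" "2 * i + 1 \<le> n" "t dvd s" "poly (lucas_poly t (2 * i + 1)) (p ^ e) = s"
proof -
  obtain z where z: "z \<in> quad_ints d" "z ^ (n div e) = \<alpha>"
    using assms by (rule fixed_class_imp_root)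
  define k where "k = n div e"
  have k: "n = e * k" using e by (simp add: k_def)
  have "n > 0" using n by (auto intro: Nat.gr0I)
  hence "e > 0" "k > 0" using k by auto
  have "odd k" using n k by auto
  then obtain i where i: "k = 2 * i + 1" by (auto elim: oddE)
  \<comment> \<open>Here \<open>e < n\<close> enters, as it forces \<open>k > 1\<close>. A positive
    \<open>i\<close> makes the power sum a nonconstant polynomial in the norm when \<open>t\<close>
    is nonzero.\<close>
  have "i > 0" using e k i by (intro Nat.gr0I) auto
  have "k \<le> n" using \<open>e > 0\<close> k by simp
  obtain t m where tm: "z + cnj z = of_int t" "z * cnj z = of_int m" "(cmod z)\<^sup>2 = of_int m"
    using z(1) by (rule quad_ints_trace_norm[OF neg])
  have "(of_int (m ^ k) :: complex) = \<alpha> * cnj \<alpha>"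
    unfolding z(2)[symmetric] k_def[symmetric] using tm(2) by (simp flip: power_mult_distrib)
  also have "\<dots> = of_int ((p ^ e) ^ k)" unfolding norm k by (simp flip: power_mult)
  finally have "m ^ k = (p ^ e) ^ k" by (simp only: of_int_eq_iff)
  moreover have "m \<ge> 0" using tm(3) by (metis of_int_0_le_iff zero_le_power2)
  ultimately have m: "m = p ^ e" using \<open>k > 0\<close> p by (simp add: power_eq_iff_eq_base)
  have "(of_int (poly (lucas_poly t k) m) :: complex) = z ^ k + cnj z ^ k"
    using tm by (intro lucas_poly_power_sum)
  also have "\<dots> = of_int s" using z(2) trace by (simp add: k_def flip: complex_cnj_power)
  finally have "poly (lucas_poly t k) m = s" by (simp only: of_int_eq_iff)
  thus ?thesis
    using that[of i t] \<open>e > 0\<close> \<open>i > 0\<close> \<open>k \<le> n\<close> dvd_poly_lucas_poly[of t i m] unfolding i m by auto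
qed

lemma not_dvd_class_number_imp_lucas:
  assumes n: "odd n" "\<not> 3 dvd n" and not_dvd: "\<not> n dvd class_number (quad_field d)"
  obtains e t i where "0 < e" "e \<le> n" "i > 0" "2 * i + 1 \<le> n" "t dvd s"
    "poly (lucas_poly t (2 * i + 1)) (p ^ e) = s"
proof -
  have "n > 0" using n by (auto intro: Nat.gr0I)
  have "\<exists>I e. I \<in> nonzero_ideals (quad_ints d) \<and> e dvd n \<and> e < n \<and> ((lin_ideal p \<alpha> ^^ e) I, I) \<in> ideal_class_rel (quad_ints d)"
  proof (rule ccontr)
    assume none: "\<nexists>I e. I \<in> nonzero_ideals (quad_ints d) \<and> e dvd n \<and> e < n \<and> ((lin_ideal p \<alpha> ^^ e) I, I) \<in> ideal_class_rel (quad_ints d)"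
    have "n dvd card (nonzero_ideals (quad_ints d) // ideal_class_rel (quad_ints d))"
    proof (rule dvd_card_quotient_if_orbits_full[OF equiv_ideal_class_rel \<open>n > 0\<close>, where T = "lin_ideal p \<alpha>"])
      fix I assume I: "I \<in> nonzero_ideals (quad_ints d)"
      show T: "lin_ideal p \<alpha> I \<in> nonzero_ideals (quad_ints d)"
        using lin_ideal_nonzero_ideals[OF I] p alpha by simp
      have "(lin_ideal p \<alpha> ^^ n) I = lin_ideal (p ^ n) \<alpha> I"
        using funpow_lin_ideal[OF I \<open>n > 0\<close>] by simp
      hence "(lin_ideal p \<alpha> ^^ n) I \<in> nonzero_ideals (quad_ints d)"
        using lin_ideal_nonzero_ideals[OF I] p alpha by simp
      moreover have "(*) 1 ` (lin_ideal p \<alpha> ^^ n) I = (*) \<alpha> ` I"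
        unfolding funpow_lin_ideal_n[OF I \<open>n > 0\<close>] by simp
      moreover have "1 \<in> quad_ints d - {0}" "\<alpha> \<in> quad_ints d - {0}"
        using quad_ints_1[OF neg] alpha alpha_nonzero by auto
      ultimately show "((lin_ideal p \<alpha> ^^ n) I, I) \<in> ideal_class_rel (quad_ints d)"
        using I unfolding ideal_class_rel_def by blast
      show "((lin_ideal p \<alpha> ^^ e) I, I) \<notin> ideal_class_rel (quad_ints d)" if "e dvd n" "e < n" for e
        using none I that by blast
    next
      fix I J assume "(I, J) \<in> ideal_class_rel (quad_ints d)"
      thus "(lin_ideal p \<alpha> I, lin_ideal p \<alpha> J) \<in> ideal_class_rel (quad_ints d)"
        using ideal_class_rel_lin_ideal p alpha by simp
    qed
    thus False using not_dvd unfolding class_number_def by simp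
  qed
  then obtain I e where Ie: "I \<in> nonzero_ideals (quad_ints d)" "e dvd n" "e < n"
    "((lin_ideal p \<alpha> ^^ e) I, I) \<in> ideal_class_rel (quad_ints d)" by blast
  obtain t i where "e > 0" "i > 0" "2 * i + 1 \<le> n" "t dvd s" "poly (lucas_poly t (2 * i + 1)) (p ^ e) = s"
    using Ie(1,2,3) n Ie(4) by (rule fixed_class_imp_lucas)
  thus ?thesis using that Ie(3) by auto
qed

end

end

text \<open>An exceptional \<open>p\<close> solves one of finitely many equations: \<open>e\<close>
  and \<open>i\<close> are bounded by \<open>n\<close>, and \<open>t\<close> divides
  \<open>2 * q\<close>. Each equation has finitely many roots \<open>p ^ e\<close>.\<close>

lemma finite_primes_not_dvd_class_number:
  fixes n q :: nat
  assumes "odd n" and "\<not> 3 dvd n" and "prime q"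
  shows "finite {p :: nat. prime p \<and> odd p \<and> p \<noteq> q \<and> q ^ 2 < p ^ n \<and>
                     \<not> n dvd class_number (K_field n p q)}" (is "finite ?B")
proof -
  define s where "s = 2 * int q"
  have "s \<noteq> 0" using \<open>prime q\<close> by (auto simp: s_def)
  define R where "R e i t = {p :: nat. poly (lucas_poly t (2 * i + 1)) (int p ^ e) = s}" for e i t
  have fin: "finite (R e i t)" if "e > 0" "i > 0" "t dvd s" for e i t
  proof -
    have "t \<noteq> 0" using that \<open>s \<noteq> 0\<close> by auto
    have "finite ((\<lambda>p :: nat. int p ^ e) -` {m. poly (lucas_poly t (2 * i + 1)) m = s})"
    proof (rule finite_vimageI)
      show "inj (\<lambda>p :: nat. int p ^ e)"
        using \<open>e > 0\<close> by (intro injI) (simp add: power_eq_iff_eq_base)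
    qed (rule finite_poly_lucas_poly_eq[OF \<open>t \<noteq> 0\<close> \<open>i > 0\<close>])
    thus ?thesis unfolding R_def by (simp add: vimage_def)
  qed
  have "?B \<subseteq> (\<Union>e\<in>{0<..n}. \<Union>i\<in>{0<..n}. \<Union>t\<in>{t. t dvd s}. R e i t)"
  proof
    fix p assume "p \<in> ?B"
    hence p: "prime p" "odd p" "p \<noteq> q" "q ^ 2 < p ^ n" "\<not> n dvd class_number (K_field n p q)" by auto
    define d where "d = int q ^ 2 - int p ^ n"
    have neg: "d < 0" using p(4) unfolding d_def by (simp flip: of_nat_power)
    define \<alpha> where "\<alpha> = of_nat q + csqrt (of_int d)"
    have "\<alpha> = of_int (int q) + of_int 1 * csqrt (of_int d)" by (simp add: \<alpha>_def)
    hence alpha: "\<alpha> \<in> ring_of_integers (quad_field d)"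
      unfolding ring_of_integers_iff[OF neg]
      by (intro quad_order_imp_almost_integral) (unfold quad_order_def, blast)
    have cnj: "cnj \<alpha> = of_nat q - csqrt (of_int d)"
      by (simp add: \<alpha>_def cnj_csqrt_neg[OF neg])
    have "\<alpha> * cnj \<alpha> = of_nat q ^ 2 - csqrt (of_int d) ^ 2"
      unfolding cnj unfolding \<alpha>_def by (simp add: algebra_simps power2_eq_square)
    hence norm: "\<alpha> * cnj \<alpha> = of_int (int p ^ n)" by (simp add: d_def)
    have trace: "\<alpha> + cnj \<alpha> = of_int s"
      unfolding cnj unfolding \<alpha>_def by (simp add: s_def)
    \<comment> \<open>That \<open>p\<close> is odd and differs from \<open>q\<close> makes it prime
      to the trace \<open>2 * q\<close>, as the powers of the ideal require.\<close>
    have "coprime p 2" "coprime p q" using p \<open>prime q\<close> by (simp_all add: primes_coprime)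
    hence "coprime (int p) s" by (simp add: s_def coprime_mult_right_iff)
    moreover have "int p > 0" using p prime_gt_0_nat by simp
    moreover have "\<not> n dvd class_number (quad_field d)" using p(5) by (simp add: K_field_def d_def)
    ultimately obtain e t i where "0 < e" "e \<le> n" "i > 0" "2 * i + 1 \<le> n" "t dvd s"
      "poly (lucas_poly t (2 * i + 1)) (int p ^ e) = s"
      using not_dvd_class_number_imp_lucas[OF neg _ _ alpha norm trace \<open>odd n\<close> \<open>\<not> 3 dvd n\<close>] by metis
    moreover from this have "e \<in> {0<..n}" "i \<in> {0<..n}" "t \<in> {t. t dvd s}" "p \<in> R e i t"
      unfolding R_def by auto
    ultimately show "p \<in> (\<Union>e\<in>{0<..n}. \<Union>i\<in>{0<..n}. \<Union>t\<in>{t. t dvd s}. R e i t)"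
      by blast
  qed
  moreover have "finite (\<Union>e\<in>{0<..n}. \<Union>i\<in>{0<..n}. \<Union>t\<in>{t. t dvd s}. R e i t)"
    using fin \<open>s \<noteq> 0\<close> by (intro finite_UN_I) auto
  ultimately show ?thesis by (rule finite_subset)
qed

subsection \<open>Infinitely many fields\<close>

text \<open>Integer polynomials, taken as real functions so that shifts by irrational square roots
  become pointwise computations.\<close>

inductive int_poly_fun :: "(real \<Rightarrow> real) \<Rightarrow> bool" where
  const: "int_poly_fun (\<lambda>_. of_int a)"
| id: "int_poly_fun (\<lambda>x. x)"
| add: "int_poly_fun f \<Longrightarrow> int_poly_fun g \<Longrightarrow> int_poly_fun (\<lambda>x. f x + g x)"
| mult: "int_poly_fun f \<Longrightarrow> int_poly_fun g \<Longrightarrow> int_poly_fun (\<lambda>x. f x * g x)"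

lemma int_poly_fun_diff: "int_poly_fun f \<Longrightarrow> int_poly_fun g \<Longrightarrow> int_poly_fun (\<lambda>x. f x - g x)"
  using int_poly_fun.add[OF _ int_poly_fun.mult[OF int_poly_fun.const[of "-1"]]] by fastforce

lemma int_poly_fun_power: "int_poly_fun f \<Longrightarrow> int_poly_fun (\<lambda>x. f x ^ k)"
  by (induction k) (use int_poly_fun.const[of 1] in \<open>auto intro: int_poly_fun.mult\<close>)

lemmas int_poly_fun_intros = int_poly_fun.intros int_poly_fun_diff int_poly_fun_power

lemma int_poly_fun_Ints: "int_poly_fun f \<Longrightarrow> f (of_int m) \<in> \<int>"
  by (induction rule: int_poly_fun.induct) auto

text \<open>Even powers of \<open>r\<close> are collected in \<open>A\<close>, odd ones in
  \<open>B\<close>. The same pair serves both square roots of \<open>c\<close>, and \<open>D\<close>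
  witnesses that \<open>A\<close> and \<open>f\<close> agree modulo \<open>c\<close>.\<close>

lemma int_poly_fun_shift_sqrt:
  assumes "int_poly_fun f"
  obtains A B D where "int_poly_fun A" "int_poly_fun B" "int_poly_fun D"
    "\<And>x r. r\<^sup>2 = of_int c \<Longrightarrow> f (x + r) = A x + r * B x" "\<And>x. A x = f x + of_int c * D x"
proof -
  have "\<exists>A B D. int_poly_fun A \<and> int_poly_fun B \<and> int_poly_fun D \<and>
      (\<forall>x r. r\<^sup>2 = of_int c \<longrightarrow> f (x + r) = A x + r * B x) \<and> (\<forall>x. A x = f x + of_int c * D x)"
    using assms
  proof (induction rule: int_poly_fun.induct)
    case (const a)
    show ?case
      by (rule exI[of _ "\<lambda>_. of_int a"], rule exI[of _ "\<lambda>_. of_int 0"], rule exI[of _ "\<lambda>_. of_int 0"])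
        (simp only: int_poly_fun.const, simp)
  next
    case id
    show ?case
      by (rule exI[of _ "\<lambda>x. x"], rule exI[of _ "\<lambda>_. of_int 1"], rule exI[of _ "\<lambda>_. of_int 0"])
        (simp only: int_poly_fun.intros, simp)
  next
    case (add f g)
    then obtain A B D A' B' D' where *: "int_poly_fun A" "int_poly_fun B" "int_poly_fun D"
      "int_poly_fun A'" "int_poly_fun B'" "int_poly_fun D'"
      "\<And>x r. r\<^sup>2 = of_int c \<Longrightarrow> f (x + r) = A x + r * B x" "\<And>x. A x = f x + of_int c * D x"
      "\<And>x r. r\<^sup>2 = of_int c \<Longrightarrow> g (x + r) = A' x + r * B' x" "\<And>x. A' x = g x + of_int c * D' x"
      by metis
    show ?case
      by (rule exI[of _ "\<lambda>x. A x + A' x"], rule exI[of _ "\<lambda>x. B x + B' x"], rule exI[of _ "\<lambda>x. D x + D' x"])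
        (use *(1-6) in \<open>simp add: int_poly_fun.add *(7,9)\<close>, simp add: *(8,10) algebra_simps)
  next
    case (mult f g)
    then obtain A B D A' B' D' where *: "int_poly_fun A" "int_poly_fun B" "int_poly_fun D"
      "int_poly_fun A'" "int_poly_fun B'" "int_poly_fun D'"
      "\<And>x r. r\<^sup>2 = of_int c \<Longrightarrow> f (x + r) = A x + r * B x" "\<And>x. A x = f x + of_int c * D x"
      "\<And>x r. r\<^sup>2 = of_int c \<Longrightarrow> g (x + r) = A' x + r * B' x" "\<And>x. A' x = g x + of_int c * D' x"
      by metis
    have "f (x + r) * g (x + r) = (A x * A' x + of_int c * (B x * B' x)) + r * (A x * B' x + A' x * B x)"
      if "r\<^sup>2 = of_int c" for x r
      unfolding *(7)[OF that] *(9)[OF that] that[symmetric] by (simp add: algebra_simps power2_eq_square)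
    moreover have "A x * A' x + of_int c * (B x * B' x) =
        f x * g x + of_int c * (f x * D' x + g x * D x + of_int c * (D x * D' x) + B x * B' x)" for x
      unfolding *(8,10) by (simp add: algebra_simps)
    ultimately show ?case using *(1-6)
      by (intro exI[of _ "\<lambda>x. A x * A' x + of_int c * (B x * B' x)"] exI[of _ "\<lambda>x. A x * B' x + A' x * B x"]
         exI[of _ "\<lambda>x. f x * D' x + g x * D x + of_int c * (D x * D' x) + B x * B' x"] conjI int_poly_fun.intros mult.hyps allI impI)
  qed
  thus ?thesis using that by blast
qed

text \<open>\<open>G\<close> is the product of \<open>x \<plusminus> \<surd>c\<^sub>1 \<plusminus> \<dots> \<plusminus> \<surd>c\<^sub>r\<close> over all choices of signs, \<open>R\<close> its largest root. It is a
  norm from the totally real multiquadratic field, so it is a norm from each \<open>\<rat>(\<surd>c\<^sub>i)\<close>, and it is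
  negative between its two largest roots, which are at least \<open>2 * s\<close> apart.\<close>

lemma exists_simultaneous_norm_form:
  fixes cs :: "int list" and s :: int
  assumes "s > 0" "\<And>c. c \<in> set cs \<Longrightarrow> s\<^sup>2 \<le> c \<and> s dvd c"
  shows "\<exists>G R D. int_poly_fun G \<and> int_poly_fun D \<and>
    (\<forall>x>R. G x > 0) \<and> (\<forall>x. R - 2 * of_int s < x \<longrightarrow> x < R \<longrightarrow> G x < 0) \<and>
    (\<forall>x. G x = x ^ (2 ^ length cs) + of_int s * D x) \<and>
    (\<forall>c\<in>set cs. \<exists>A B. int_poly_fun A \<and> int_poly_fun B \<and> (\<forall>x. G x = (A x)\<^sup>2 - of_int c * (B x)\<^sup>2))"
  using assms(2)
proof (induction cs)
  case Nil
  show ?case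
    by (rule exI[of _ "\<lambda>x. x"], rule exI[of _ 0], rule exI[of _ "\<lambda>_. of_int 0"])
      (simp only: int_poly_fun.intros, simp)
next
  case (Cons c cs)
  obtain G R D where G: "int_poly_fun G" "int_poly_fun D" "\<And>x. x > R \<Longrightarrow> G x > 0"
    "\<And>x. R - 2 * of_int s < x \<Longrightarrow> x < R \<Longrightarrow> G x < 0"
    "\<And>x. G x = x ^ (2 ^ length cs) + of_int s * D x"
    and norms: "\<And>c. c \<in> set cs \<Longrightarrow>
      \<exists>A B. int_poly_fun A \<and> int_poly_fun B \<and> (\<forall>x. G x = (A x)\<^sup>2 - of_int c * (B x)\<^sup>2)"
    using Cons by (metis list.set_intros(2))
  define r where "r = sqrt (of_int c)"
  have "s\<^sup>2 \<le> c" "s dvd c" using Cons.prems by auto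
  then obtain j where j: "c = s * j" by auto
  have "0 \<le> c" using \<open>s\<^sup>2 \<le> c\<close> zero_le_power2[of s] by linarith
  hence r2: "r\<^sup>2 = of_int c" "(- r)\<^sup>2 = of_int c" by (simp_all add: r_def)
  have "(of_int s)\<^sup>2 \<le> (of_int c :: real)" using \<open>s\<^sup>2 \<le> c\<close> by (simp flip: of_int_power)
  hence "of_int s \<le> r" unfolding r_def by (rule real_le_rsqrt)
  hence "r > 0" using \<open>s > 0\<close> by (smt (verit) of_int_0_less_iff)
  obtain A B E where A: "int_poly_fun A" "int_poly_fun B" "int_poly_fun E"
    "\<And>x r. r\<^sup>2 = of_int c \<Longrightarrow> G (x + r) = A x + r * B x" "\<And>x. A x = G x + of_int c * E x"
    using int_poly_fun_shift_sqrt[OF G(1), of c] by blast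
  \<comment> \<open>Adjoining the square root \<open>r\<close> of \<open>c\<close> replaces
    \<open>G x\<close> by \<open>G (x + r) * G (x - r)\<close>, which is visibly a norm for
    \<open>c\<close>.\<close>
  define H where "H x = (A x)\<^sup>2 - of_int c * (B x)\<^sup>2" for x
  have H: "H x = G (x + r) * G (x - r)" for x
  proof -
    have G: "G (x + r) = A x + r * B x" "G (x - r) = A x - r * B x"
      using A(4)[OF r2(1), of x] A(4)[OF r2(2), of x] by simp_all
    show ?thesis unfolding H_def r2(1)[symmetric] G by (simp add: algebra_simps power2_eq_square)
  qed
  define F where "F x = 2 * x ^ (2 ^ length cs) * (D x + of_int j * E x) + of_int s * (D x + of_int j * E x)\<^sup>2 - of_int j * (B x)\<^sup>2" for x
  have "int_poly_fun (\<lambda>x. of_int 2 * x ^ (2 ^ length cs) * (D x + of_int j * E x) + of_int s * (D x + of_int j * E x)\<^sup>2 - of_int j * (B x)\<^sup>2)"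
    using G(2) A by (intro int_poly_fun_intros)
  hence F: "int_poly_fun F" by (simp add: F_def[abs_def])
  show ?case
  proof (rule exI[of _ H], rule exI[of _ "R + r"], rule exI[of _ F], intro conjI ballI allI impI F)
    show "int_poly_fun H" unfolding H_def[abs_def] using A by (intro int_poly_fun_intros)
    show "0 < H x" if "R + r < x" for x
      unfolding H using that \<open>r > 0\<close> by (intro mult_pos_pos G(3)) auto
    \<comment> \<open>On this interval \<open>x - r\<close> lies in the negative interval of
      \<open>G\<close>, while \<open>r \<ge> s\<close> puts \<open>x + r\<close> beyond
      \<open>R\<close>.\<close>
    show "H x < 0" if "R + r - 2 * of_int s < x" "x < R + r" for x
      unfolding H using that \<open>of_int s \<le> r\<close> by (intro mult_pos_neg G(3) G(4)) auto
    show "H x = x ^ 2 ^ length (c # cs) + of_int s * F x" for x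
    proof -
      have "A x = x ^ (2 ^ length cs) + of_int s * (D x + of_int j * E x)"
        unfolding A(5) G(5) j by (simp add: algebra_simps)
      hence "H x = (x ^ (2 ^ length cs))\<^sup>2 + of_int s * F x"
        unfolding H_def F_def by (simp add: j algebra_simps power2_eq_square)
      thus ?thesis by (simp add: mult.commute flip: power_mult)
    qed
    fix c' assume "c' \<in> set (c # cs)"
    show "\<exists>A B. int_poly_fun A \<and> int_poly_fun B \<and> (\<forall>x. H x = (A x)\<^sup>2 - of_int c' * (B x)\<^sup>2)"
    proof (cases "c' = c")
      case False
      then obtain U V where UV: "int_poly_fun U" "int_poly_fun V" "\<And>x. G x = (U x)\<^sup>2 - of_int c' * (V x)\<^sup>2"
        using norms[of c'] \<open>c' \<in> set (c # cs)\<close> by (simp, metis)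
      obtain U1 U2 where U: "int_poly_fun U1" "int_poly_fun U2" "\<And>x r. r\<^sup>2 = of_int c \<Longrightarrow> U (x + r) = U1 x + r * U2 x"
        using int_poly_fun_shift_sqrt[OF UV(1)] by metis
      obtain V1 V2 where V: "int_poly_fun V1" "int_poly_fun V2" "\<And>x r. r\<^sup>2 = of_int c \<Longrightarrow> V (x + r) = V1 x + r * V2 x"
        using int_poly_fun_shift_sqrt[OF UV(2)] by metis
      \<comment> \<open>Both factors of \<open>H x\<close> are norms for \<open>c'\<close>, and so
        is their product, by Brahmagupta's identity. The resulting components are symmetric under
        \<open>r \<mapsto> - r\<close>, hence free of \<open>r\<close>.\<close>
      have "H x = ((U1 x)\<^sup>2 - of_int c * (U2 x)\<^sup>2 + of_int c' * ((V1 x)\<^sup>2 - of_int c * (V2 x)\<^sup>2))\<^sup>2 -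
          of_int c' * (of_int 2 * (U1 x * V1 x - of_int c * (U2 x * V2 x)))\<^sup>2" for x
      proof -
        have UV': "U (x + r) = U1 x + r * U2 x" "U (x - r) = U1 x - r * U2 x"
          "V (x + r) = V1 x + r * V2 x" "V (x - r) = V1 x - r * V2 x"
          using U(3)[OF r2(1), of x] U(3)[OF r2(2), of x] V(3)[OF r2(1), of x] V(3)[OF r2(2), of x] by simp_all
        show ?thesis unfolding H UV(3) r2(1)[symmetric] UV' by (simp add: algebra_simps power2_eq_square)
      qed
      moreover have "int_poly_fun (\<lambda>x. (U1 x)\<^sup>2 - of_int c * (U2 x)\<^sup>2 + of_int c' * ((V1 x)\<^sup>2 - of_int c * (V2 x)\<^sup>2))"
        "int_poly_fun (\<lambda>x. of_int 2 * (U1 x * V1 x - of_int c * (U2 x * V2 x)))"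
        by (intro int_poly_fun_intros U(1,2) V(1,2))+
      ultimately show ?thesis by blast
    qed (use A H_def in blast)
  qed
qed

text \<open>The form for the numbers \<open>s\<^sup>2 * D\<close> is negative on an interval of
  length \<open>2 * s\<close>, which contains an integer \<open>a\<close> congruent to 1 modulo
  \<open>s\<close>. Modulo \<open>s\<close> the form is a pure power, so its value at
  \<open>a\<close> is 1.\<close>

lemma exists_negative_simultaneous_norm:
  fixes S :: "int set" and s :: int
  assumes "s > 0" "finite S" "\<And>D. D \<in> S \<Longrightarrow> D > 0"
  obtains N :: int where "N < 0" "[N = 1] (mod s)" "\<And>D. D \<in> S \<Longrightarrow> \<exists>x y. N = x\<^sup>2 - D * y\<^sup>2"
proof -
  obtain Ds where Ds: "set Ds = S" using finite_list[OF \<open>finite S\<close>] by blast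
  define cs where "cs = map (\<lambda>D. s\<^sup>2 * D) Ds"
  have cs: "s\<^sup>2 \<le> c \<and> s dvd c" if c: "c \<in> set cs" for c
  proof -
    obtain D where D: "D \<in> S" "c = s\<^sup>2 * D" using c Ds unfolding cs_def by auto
    have "D \<ge> 1" using assms(3)[OF D(1)] by simp
    hence "s\<^sup>2 * 1 \<le> s\<^sup>2 * D" by (intro mult_left_mono) auto
    thus ?thesis using D by (simp add: power2_eq_square)
  qed
  obtain G R E where G: "int_poly_fun G" "int_poly_fun E"
    "\<And>x. R - 2 * of_int s < x \<Longrightarrow> x < R \<Longrightarrow> G x < 0"
    "\<And>x. G x = x ^ (2 ^ length cs) + of_int s * E x"
    and norms: "\<And>c. c \<in> set cs \<Longrightarrow>
      \<exists>A B. int_poly_fun A \<and> int_poly_fun B \<and> (\<forall>x. G x = (A x)\<^sup>2 - of_int c * (B x)\<^sup>2)"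
    using exists_simultaneous_norm_form[of s cs] \<open>s > 0\<close> cs by metis
  \<comment> \<open>The largest \<open>k\<close> with \<open>1 + s * k < R\<close>; hence
    \<open>R - s \<le> a < R\<close>.\<close>
  define k where "k = \<lceil>(R - 1) / of_int s\<rceil> - 1"
  define a where "a = 1 + s * k"
  have s: "real_of_int s > 0" using \<open>s > 0\<close> by simp
  have "of_int k < (R - 1) / of_int s" "(R - 1) / of_int s \<le> of_int k + 1"
    unfolding k_def by linarith+
  hence "of_int a < R" "R - 2 * of_int s < of_int a"
    using s by (simp_all add: a_def field_simps)
  hence neg: "G (of_int a) < 0" using G(3) by blast
  obtain N where N: "G (of_int a) = of_int N" using int_poly_fun_Ints[OF G(1)] by (auto elim: Ints_cases)
  obtain e where e: "E (of_int a) = of_int e" using int_poly_fun_Ints[OF G(2)] by (auto elim: Ints_cases)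
  have "real_of_int N = of_int (a ^ (2 ^ length cs) + s * e)"
    using G(4)[of "of_int a"] N e by simp
  hence "N = a ^ (2 ^ length cs) + s * e" by (simp only: of_int_eq_iff)
  hence "[N = a ^ (2 ^ length cs)] (mod s)" by (simp add: cong_def)
  also have "[a = 1] (mod s)" by (simp add: a_def cong_def)
  hence "[a ^ (2 ^ length cs) = 1 ^ (2 ^ length cs)] (mod s)" by (rule cong_pow)
  finally have "[N = 1] (mod s)" by simp
  moreover have "N < 0" using neg N by simp
  moreover have "\<exists>x y. N = x\<^sup>2 - D * y\<^sup>2" if "D \<in> S" for D
  proof -
    have "s\<^sup>2 * D \<in> set cs" using that Ds by (auto simp: cs_def)
    then obtain A B where AB: "int_poly_fun A" "int_poly_fun B" "\<And>x. G x = (A x)\<^sup>2 - of_int (s\<^sup>2 * D) * (B x)\<^sup>2"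
      using norms by blast
    obtain x where x: "A (of_int a) = of_int x" using int_poly_fun_Ints[OF AB(1)] by (auto elim: Ints_cases)
    obtain y where y: "B (of_int a) = of_int y" using int_poly_fun_Ints[OF AB(2)] by (auto elim: Ints_cases)
    have "real_of_int N = of_int (x\<^sup>2 - D * (s * y)\<^sup>2)"
      using AB(3)[of "of_int a"] N x y by (simp add: power_mult_distrib mult_ac)
    hence "N = x\<^sup>2 - D * (s * y)\<^sup>2" by (simp only: of_int_eq_iff)
    thus ?thesis by blast
  qed
  ultimately show ?thesis using that by blast
qed

section \<open>Primes congruent to 3 modulo 4 and quadratic residues\<close>

text \<open>Descent: if \<open>p\<close> does not divide \<open>y\<close>, then \<open>x / y\<close>
  is a square root of \<open>D\<close> modulo \<open>p\<close>. Otherwise \<open>p\<close> divides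
  both \<open>x\<close> and \<open>y\<close>, and cancelling \<open>p\<^sup>2\<close> preserves the
  parity of the multiplicity.\<close>

lemma square_mod_prime_if_odd_multiplicity_norm:
  fixes p D :: int
  assumes p: "prime p" and "\<not> p dvd D"
  shows "N = x\<^sup>2 - D * y\<^sup>2 \<Longrightarrow> odd (multiplicity p N) \<Longrightarrow> N \<noteq> 0 \<Longrightarrow> \<exists>w. p dvd w\<^sup>2 - D"
proof (induction "nat \<bar>N\<bar>" arbitrary: N x y rule: less_induct)
  case less
  have "p dvd N"
    using less.prems(2) not_dvd_imp_multiplicity_0 by fastforce
  show ?case
  proof (cases "p dvd y")
    case False
    hence "coprime y p" using p by (simp add: prime_imp_coprime coprime_commute)
    then obtain y' where "[y * y' = 1] (mod p)" using cong_solve_coprime_int by blast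
    then obtain u where u: "y * y' = 1 + p * u"
      by (metis cong_iff_lin cong_sym)
    have "(x * y')\<^sup>2 - D = N * y'\<^sup>2 + D * ((y * y')\<^sup>2 - 1)"
      unfolding less.prems(1) by (simp add: algebra_simps power2_eq_square)
    also have "(y * y')\<^sup>2 - 1 = p * (u * (2 + p * u))"
      unfolding u by (simp add: algebra_simps power2_eq_square)
    finally have "p dvd (x * y')\<^sup>2 - D" using \<open>p dvd N\<close> by simp
    thus ?thesis by blast
  next
    case True
    then obtain v where v: "y = p * v" by auto
    have "x\<^sup>2 = N + D * y\<^sup>2" using less.prems(1) by simp
    hence "p dvd x\<^sup>2" using \<open>p dvd N\<close> v by (simp add: power2_eq_square)
    hence "p dvd x" using p prime_dvd_power by blast
    then obtain u where u: "x = p * u" by auto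
    define M where "M = u\<^sup>2 - D * v\<^sup>2"
    have N: "N = p\<^sup>2 * M" using less.prems(1) by (simp add: M_def u v algebra_simps power2_eq_square)
    have "M \<noteq> 0" using N less.prems(3) by auto
    have "multiplicity p N = 2 + multiplicity p M"
      using p \<open>M \<noteq> 0\<close> unfolding N
      by (subst prime_elem_multiplicity_mult_distrib) (auto simp: multiplicity_same_power)
    hence "odd (multiplicity p M)" using less.prems(2) by simp
    moreover have "p\<^sup>2 > 1" using prime_gt_1_int[OF p] by (simp add: one_less_power)
    hence "\<bar>M\<bar> < \<bar>N\<bar>" using \<open>M \<noteq> 0\<close> unfolding N abs_mult by (simp add: mult_less_cancel_right1)
    hence "nat \<bar>M\<bar> < nat \<bar>N\<bar>" by simp
    ultimately show ?thesis using less.hyps[of M u v] M_def \<open>M \<noteq> 0\<close> by blast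
  qed
qed

text \<open>Otherwise every prime power in the factorization of \<open>W\<close> would be 1 modulo
  4, and so would \<open>W\<close>.\<close>

lemma exists_prime_factor_3_mod_4:
  fixes W :: nat
  assumes "W mod 4 = 3"
  shows "\<exists>p. prime p \<and> p mod 4 = 3 \<and> odd (multiplicity p W)"
proof (rule ccontr)
  assume "\<nexists>p. prime p \<and> p mod 4 = 3 \<and> odd (multiplicity p W)"
  hence even: "even (multiplicity p W)" if "prime p" "p mod 4 = 3" for p using that by blast
  have "W \<noteq> 0" using assms by auto
  have "odd W" using assms by presburger
  have "[p ^ multiplicity p W = 1] (mod 4)" if p: "p \<in> prime_factors W" for p
  proof -
    have "prime p" "p dvd W" using p by auto
    hence "odd p" using \<open>odd W\<close> by (metis dvd_trans)
    hence "p mod 4 = 1 \<or> p mod 4 = 3" by presburger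
    thus ?thesis
    proof
      assume "p mod 4 = 1"
      hence "[p = 1] (mod 4)" by (simp add: cong_def)
      thus ?thesis using cong_pow by fastforce
    next
      assume 3: "p mod 4 = 3"
      then obtain k where k: "multiplicity p W = 2 * k" using even \<open>prime p\<close> by (auto elim: evenE)
      have "p\<^sup>2 mod 4 = (p mod 4)\<^sup>2 mod 4" by (simp add: power_mod)
      hence "[p\<^sup>2 = 1] (mod 4)" unfolding 3 by (simp add: cong_def)
      hence "[(p\<^sup>2) ^ k = 1 ^ k] (mod 4)" by (rule cong_pow)
      thus ?thesis unfolding k by (simp add: power_mult)
    qed
  qed
  hence "[(\<Prod>p\<in>prime_factors W. p ^ multiplicity p W) = (\<Prod>p\<in>prime_factors W. 1)] (mod 4)"
    by (rule cong_prod)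
  moreover have "(\<Prod>p\<in>prime_factors W. p ^ multiplicity p W) = W"
    using \<open>W \<noteq> 0\<close> by (simp add: prod_prime_factors)
  ultimately have "W mod 4 = 1" by (simp add: cong_def)
  thus False using assms by simp
qed

text \<open>Raising \<open>x\<^sup>2 \<equiv> - y\<^sup>2\<close> to the odd power
  \<open>(p - 1) / 2\<close> would give \<open>1 \<equiv> -1\<close> by Fermat's theorem.\<close>

lemma prime_3_mod_4_dvd_sum_squares:
  fixes p :: nat and x y :: int
  assumes p: "prime p" "p mod 4 = 3" and dvd: "int p dvd x\<^sup>2 + y\<^sup>2"
  shows "int p dvd x"
proof (rule ccontr)
  assume nx: "\<not> int p dvd x"
  have ny: "\<not> int p dvd y"
  proof
    assume "int p dvd y"
    hence "int p dvd y\<^sup>2" by (simp add: power2_eq_square)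
    with dvd have "int p dvd (x\<^sup>2 + y\<^sup>2) - y\<^sup>2" by (rule dvd_diff)
    thus False using nx p prime_dvd_power[of "int p" x 2] by simp
  qed
  define k where "k = p div 2"
  have k: "p - 1 = 2 * k" "odd k" using p(2) unfolding k_def by presburger+
  have fermat: "[z ^ (p - 1) = 1] (mod int p)" if z: "\<not> int p dvd z" for z :: int
  proof -
    define a where "a = nat (z mod int p)"
    have a: "int a = z mod int p" using p(1) prime_gt_0_nat by (simp add: a_def)
    have "\<not> int p dvd int a" unfolding a using z by (simp add: dvd_mod_iff)
    hence "[a ^ (p - 1) = 1] (mod p)" using fermat_theorem[OF p(1)] by simp
    hence "[int a ^ (p - 1) = 1] (mod int p)" by (metis cong_int_iff of_nat_1 of_nat_power)
    moreover have "[int a = z] (mod int p)" unfolding a by (simp add: cong_def)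
    hence "[int a ^ (p - 1) = z ^ (p - 1)] (mod int p)" by (rule cong_pow)
    ultimately show ?thesis using cong_sym cong_trans by blast
  qed
  have "[x\<^sup>2 = - (y\<^sup>2)] (mod int p)" using dvd by (simp add: cong_iff_dvd_diff)
  hence "[(x\<^sup>2) ^ k = (- (y\<^sup>2)) ^ k] (mod int p)" by (rule cong_pow)
  hence "[x ^ (p - 1) = - (y ^ (p - 1))] (mod int p)"
    using k by (simp add: power_minus_odd power_mult)
  moreover have "[- (y ^ (p - 1)) = - 1] (mod int p)" using fermat[OF ny] by (simp add: cong_minus_minus_iff)
  ultimately have "[1 = - 1] (mod int p)" using fermat[OF nx] by (meson cong_sym cong_trans)
  hence "int p dvd 2" by (simp add: cong_iff_dvd_diff)
  hence "p \<le> 2" by (auto dest: zdvd_imp_le)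
  thus False using p(2) prime_ge_2_nat[OF p(1)] by (simp add: le_antisym)
qed

text \<open>A negative simultaneous norm \<open>N\<close> with \<open>N \<equiv> 1\<close> modulo 4 has a prime factor congruent to 3 modulo 4 of odd
  multiplicity, and odd multiplicity forces every \<open>D\<close> to be a square modulo that prime. This replaces
  Dirichlet's theorem, which would provide a prime \<open>p \<equiv> -1\<close> modulo \<open>4 * \<Prod>S\<close>.\<close>

lemma exists_prime_3_mod_4_squares:
  fixes S :: "int set"
  assumes "finite S" "\<And>D. D \<in> S \<Longrightarrow> D > 0"
  obtains p :: nat where "prime p" "p > b" "p mod 4 = 3"
    "\<And>D. D \<in> S \<Longrightarrow> \<not> int p dvd D" "\<And>D. D \<in> S \<Longrightarrow> \<exists>w. int p dvd w\<^sup>2 - D"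
proof -
  \<comment> \<open>Since \<open>N \<equiv> 1\<close> modulo \<open>s\<close>, prime factors of
    \<open>N\<close> are prime to \<open>s\<close>. The factor 4 fixes \<open>N\<close> modulo 4,
    the factorial pushes the prime beyond \<open>b\<close>, and the product keeps it from dividing
    any \<open>D\<close>.\<close>
  define s where "s = 4 * fact b * (\<Prod>D\<in>S. D)"
  have "(\<Prod>D\<in>S. D) > 0" using assms by (intro prod_pos) auto
  hence "s > 0" by (simp add: s_def)
  obtain N where N: "N < 0" "[N = 1] (mod s)" "\<And>D. D \<in> S \<Longrightarrow> \<exists>x y. N = x\<^sup>2 - D * y\<^sup>2"
    using exists_negative_simultaneous_norm[OF \<open>s > 0\<close> assms] by blast
  define W where "W = nat (- N)"
  have W: "N = - int W" using N by (simp add: W_def)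
  have "4 dvd s" by (simp add: s_def)
  hence "[N = 1] (mod 4)" using N(2) cong_dvd_modulus by blast
  hence "(- int W) mod 4 = 1" unfolding W cong_def by simp
  hence "int W mod 4 = 3" by presburger
  hence "W mod 4 = 3" by presburger
  then obtain p where p: "prime p" "p mod 4 = 3" "odd (multiplicity p W)"
    using exists_prime_factor_3_mod_4 by blast
  have mult: "multiplicity (int p) N = multiplicity p W"
    unfolding W multiplicity_def by (simp flip: of_nat_power)
  have "int p dvd N"
    using p(3) mult not_dvd_imp_multiplicity_0[of "int p" N] by fastforce
  have nds: "\<not> int p dvd s"
  proof
    assume "int p dvd s"
    hence "[N = 1] (mod int p)" using N(2) cong_dvd_modulus by blast
    hence "int p dvd 1" using \<open>int p dvd N\<close> cong_dvd_iff cong_sym by blast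
    thus False using p(1) by (simp add: prime_nat_iff)
  qed
  have "p > b"
  proof (rule ccontr)
    assume "\<not> p > b"
    hence "p dvd fact b" using prime_gt_0_nat[OF p(1)] by (intro dvd_fact) auto
    hence "int p dvd fact b" by (metis of_nat_dvd_iff of_nat_fact)
    thus False using nds by (simp add: s_def)
  qed
  moreover have "\<not> int p dvd D" if "D \<in> S" for D
  proof
    assume "int p dvd D"
    moreover have "D dvd (\<Prod>D\<in>S. D)" using that assms by (intro dvd_prodI)
    ultimately show False using nds unfolding s_def by (metis dvd_mult dvd_trans)
  qed
  moreover have "\<exists>w. int p dvd w\<^sup>2 - D" if "D \<in> S" for D
  proof -
    obtain x y where "N = x\<^sup>2 - D * y\<^sup>2" using N(3) \<open>D \<in> S\<close> by blast
    thus ?thesis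
      using square_mod_prime_if_odd_multiplicity_norm[of "int p" D N x y] p mult N(1) calculation(2)[OF that] by simp
  qed
  ultimately show ?thesis using that p by blast
qed

section \<open>Comparison of the fields\<close>

text \<open>The imaginary parts in \<open>csqrt (- D) = a + b * csqrt (- D')\<close> give
  \<open>D = b\<^sup>2 * D'\<close> with rational \<open>b\<close>.\<close>

lemma quad_field_eq_imp_ratio_square:
  assumes "quad_field (- D) = quad_field (- D')" "D > 0" "D' > 0"
  obtains u v :: int where "v \<noteq> 0" "coprime u v" "v\<^sup>2 * D = u\<^sup>2 * D'"
proof -
  have "csqrt (of_int (- D)) \<in> quad_field (- D)"
    unfolding quad_field_def by (rule CollectI, rule exI[of _ 0], rule exI[of _ 1]) simp
  then obtain a b where ab: "csqrt (of_int (- D)) = of_real a + of_real b * csqrt (of_int (- D'))" "b \<in> \<rat>"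
    unfolding assms(1) unfolding quad_field_def by blast
  have "Im (csqrt (of_int (- D))) = b * Im (csqrt (of_int (- D')))"
    using arg_cong[OF ab(1), of Im] by simp
  hence "sqrt (of_int D) = b * sqrt (of_int D')" using assms by simp
  hence "(sqrt (of_int D))\<^sup>2 = b\<^sup>2 * (sqrt (of_int D'))\<^sup>2" by (simp add: power_mult_distrib)
  hence D: "of_int D = b\<^sup>2 * of_int D'" using assms by simp
  obtain u v where uv: "v > 0" "coprime u v" "b = of_int u / of_int v"
    using ab(2) by (auto elim: Rats_cases')
  have "real_of_int (v\<^sup>2 * D) = of_int (u\<^sup>2 * D')"
    using uv(1) by (simp add: D uv(3) power_divide)
  hence "v\<^sup>2 * D = u\<^sup>2 * D'" by (simp only: of_int_eq_iff)
  thus ?thesis using that[of v u] uv(1,2) by simp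
qed

lemma infinite_K_fields:
  fixes n q :: nat
  assumes "n \<ge> 2" "prime q"
  shows "infinite ((\<lambda>p. K_field n p q) ` {p :: nat. prime p \<and> odd p \<and> p \<noteq> q \<and> q ^ 2 < p ^ n})" (is "infinite (_ ` ?P)")
proof
  assume "finite ((\<lambda>p. K_field n p q) ` ?P)"
  \<comment> \<open>\<open>C\<close> holds finitely many primes whose fields exhaust the family. The
    new prime \<open>p\<close> need only share its field with some \<open>p'\<close> in
    \<open>C\<close>.\<close>
  hence "\<exists>C\<subseteq>?P. finite C \<and> (\<lambda>p. K_field n p q) ` ?P = (\<lambda>p. K_field n p q) ` C"
    by (rule finite_subset_image) (rule order_refl)
  then obtain C where C: "C \<subseteq> ?P" "finite C" "(\<lambda>p. K_field n p q) ` ?P = (\<lambda>p. K_field n p q) ` C"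
    by (elim exE conjE)
  define E where "E p = int p ^ n - int q ^ 2" for p
  have K: "K_field n p q = quad_field (- E p)" for p by (simp add: K_field_def E_def)
  have pos: "E p > 0" if "p \<in> ?P" for p
    using that by (simp add: E_def flip: of_nat_power)
  obtain p where p: "prime p" "p > q" "p mod 4 = 3" "\<And>D. D \<in> E ` C \<Longrightarrow> \<not> int p dvd D"
    "\<And>D. D \<in> E ` C \<Longrightarrow> \<exists>w. int p dvd w\<^sup>2 - D"
    using exists_prime_3_mod_4_squares[of "E ` C" q] C pos by blast
  have "q ^ 2 < p ^ 2" using p(2) by (intro power_strict_mono) auto
  also have "p ^ 2 \<le> p ^ n" using prime_gt_0_nat[OF p(1)] \<open>n \<ge> 2\<close> by (intro power_increasing) auto
  finally have "q ^ 2 < p ^ n" .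
  moreover have "odd p" using p(3) by presburger
  ultimately have "p \<in> ?P" using p(1,2) by simp
  hence "K_field n p q \<in> (\<lambda>p. K_field n p q) ` C"
    unfolding C(3)[symmetric] by (rule imageI)
  then obtain p' where p': "p' \<in> C" "quad_field (- E p) = quad_field (- E p')"
    unfolding K by (elim imageE)
  obtain u v where uv: "v \<noteq> 0" "coprime u v" "v\<^sup>2 * E p = u\<^sup>2 * E p'"
    using quad_field_eq_imp_ratio_square[OF p'(2) pos[OF \<open>p \<in> ?P\<close>] pos[OF subsetD[OF C(1) p'(1)]]] .
  obtain w where w: "int p dvd w\<^sup>2 - E p'" using p(5) p'(1) by blast
  have prime: "prime (int p)" using p(1) by simp
  have "\<not> int p dvd w"
  proof
    assume "int p dvd w"
    hence "int p dvd w\<^sup>2" by (simp add: power2_eq_square)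
    hence "int p dvd w\<^sup>2 - (w\<^sup>2 - E p')" using w by (rule dvd_diff)
    thus False using p(4) p'(1) by auto
  qed
  have "\<not> int p dvd int q" using p \<open>prime q\<close> by (auto dest: primes_dvd_imp_eq)
  \<comment> \<open>Modulo \<open>p\<close>, \<open>E p\<close> is \<open>- q\<^sup>2\<close> and
    \<open>E p'\<close> is \<open>w\<^sup>2\<close>, so the relation between them becomes a
    vanishing sum of two squares.\<close>
  have "(u * w)\<^sup>2 + (v * int q)\<^sup>2 = u\<^sup>2 * (w\<^sup>2 - E p') + v\<^sup>2 * int p ^ n"
    using uv(3) by (simp add: E_def algebra_simps power_mult_distrib)
  also have "int p dvd \<dots>" using w \<open>n \<ge> 2\<close> by (intro dvd_add dvd_mult) auto
  finally have "int p dvd (u * w)\<^sup>2 + (v * int q)\<^sup>2" .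
  hence "int p dvd u * w" "int p dvd v * int q"
    using prime_3_mod_4_dvd_sum_squares[OF p(1,3)] by (blast, metis add.commute)
  hence "int p dvd u" "int p dvd v"
    using \<open>\<not> int p dvd w\<close> \<open>\<not> int p dvd int q\<close> prime prime_dvd_mult_iff by blast+
  thus False using uv(2) prime by (meson coprime_common_divisor not_prime_unit)
qed

theorem theorem2:
  fixes n q :: nat
  assumes "odd n" and "n \<ge> 3" and "\<not> 3 dvd n"
    and "prime q" and "odd q"
  shows "finite {p :: nat. prime p \<and> odd p \<and> p \<noteq> q \<and> q ^ 2 < p ^ n \<and>
                     \<not> n dvd class_number (K_field n p q)}
       \<and> infinite ((\<lambda>p. K_field n p q) ` {p :: nat. prime p \<and> odd p \<and> p \<noteq> q \<and> q ^ 2 < p ^ n})"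
  using finite_primes_not_dvd_class_number[of n q] infinite_K_fields[of n q] assms by simp

end
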